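(* Let $\{B_1(t),t\ge 0\}$ be a standard Brownian motion. For any $c>0$ and any two constants $T_2>T_1>0$, $$\mathbb{P}\Big\{\inf_{t\in[T_1,T_2]}\big(B_1(t)-ct\big)>u\Big\}=K_{c,T_2-T_1}\,\frac{T_1}{u}\,\Psi\!\left(\frac{u+cT_1}{\sqrt{T_1}}\right)(1+o(1)),\qquad u\to\infty,$$ where $$K_{c,y}=2\varphi(c\sqrt{y})\frac{1}{\sqrt{y}}-2c\,\Psi(c\sqrt{y})>0,\qquad y>0.$$
   Context: $\varphi$ denotes the density and $\Psi$ the tail distribution function (i.e. $\Psi(x)=\mathbb{P}\{\mathcal N>x\}$) of a standard normal $N(0,1)$ random variable $\mathcal N$. The notation $f(u)=g(u)(1+o(1))$ means $f(u)/g(u)\to 1$. *)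

theory Defs
  imports "HOL-Probability.Probability"
begin

text \<open>
  Every sample path is continuous on the nonnegative half-line, as usual for a continuous process.
  The index type is the reals, but only times $t \geq 0$ are constrained.
\<close>

locale standard_brownian_motion = prob_space M
  for M :: "'a measure" and B :: "real \<Rightarrow> 'a \<Rightarrow> real" +
  assumes random_variable_at: "\<And>t. 0 \<le> t \<Longrightarrow> random_variable borel (B t)"
    and starts_at_zero: "AE \<omega> in M. B 0 \<omega> = 0"
    and independent_increments:
      "\<And>(t :: nat \<Rightarrow> real) n. \<lbrakk>0 \<le> t 0; \<forall>i<n. t i < t (Suc i)\<rbrakk> \<Longrightarrow>
        indep_vars (\<lambda>_. borel) (\<lambda>i \<omega>. B (t (Suc i)) \<omega> - B (t i) \<omega>) {..<n}"
    and normal_increments: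
      "\<And>s t. \<lbrakk>0 \<le> s; s < t\<rbrakk> \<Longrightarrow>
        distributed M lborel (\<lambda>\<omega>. B t \<omega> - B s \<omega>) (normal_density 0 (sqrt (t - s)))"
    and continuous_paths: "\<And>\<omega>. \<omega> \<in> space M \<Longrightarrow> continuous_on {0..} (\<lambda>t. B t \<omega>)"

definition std_normal_tail :: "real \<Rightarrow> real" where
  "std_normal_tail x = measure (density lborel std_normal_density) {x<..}"

definition K_const :: "real \<Rightarrow> real \<Rightarrow> real" where
  "K_const c y =
    2 * std_normal_density (c * sqrt y) * (1 / sqrt y) - 2 * c * std_normal_tail (c * sqrt y)"

end

(* The function surv c t, a Gaussian tail minus exp (2 c x) times its mirror image, is the mean of
   the antisymmetrised indicator h = 1_{x > 0} - exp (2 c x) 1_{x < 0} under Brownian motion with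
   drift -c started at x, run for time t; it is odd up to the factor exp (2 c x), hence has the sign
   of x. So by independent increments E[h(X(T2) - b); X(T1) > u] splits, along the first grid time at
   which X(t) = B(t) - c t falls to u, into the probability of staying above u and a
   remainder that is nonpositive for b = u and, for b < u, at least minus the probability of a grid
   step larger than u - b. Refining the grid gives
   P(inf X > u) = integral over z > 0 of surv c (T2 - T1) z times the density of X(T1) at u + z.
   The Gaussian weight concentrates at scale T1/u, where surv c t z ~ K_const c t * z. *)

theory Submission
  imports Defs "HOL-Real_Asymp.Real_Asymp"
begin

section \<open>The Gaussian tail\<close>

text \<open>The weight comes from drift reversal: \<open>exp (2 * c * x)\<close> has constant mean
  along Brownian motion with drift \<open>-c\<close>, and tilting by it turns the drift into
  \<open>+c\<close>, which is also what mirroring the path at 0 does. Averaging over an increment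
  therefore preserves the relation f(-x) = - exp(-2cx) f(x), and a start at the mirror has mean 0.
  The obstacle is the first passage. In continuous time it would call for a strong Markov property;
  on a grid it takes finitely many values, and independence at fixed times suffices. The price is
  that the path lands at or below u instead of on it, so the remainder has a sign instead of
  vanishing, and a mirror at u bounds the probability from one side only. A mirror at b below u
  gives the other side: landing in [b, u] contributes with the opposite sign, and landing lower
  takes a large step, which path continuity rules out in the limit. The constant is the slope of
  \<open>surv\<close> at 0. Since \<open>surv\<close> vanishes there to first order, the integral is
  smaller than the plain Gaussian tail by one factor of order T1/u.\<close>

abbreviation \<Psi> :: "real \<Rightarrow> real" where "\<Psi> \<equiv> std_normal_tail"

lemma integrable_normal_density_bounded_mult:
  fixes g :: "real \<Rightarrow> real"
  assumes [measurable]: "g \<in> borel_measurable borel"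
    and "0 < \<sigma>" and "\<And>x. \<bar>g x\<bar> \<le> C"
  shows "integrable lborel (\<lambda>x. normal_density m \<sigma> x * g x)"
proof (rule Bochner_Integration.integrable_bound)
  show "integrable lborel (\<lambda>x. normal_density m \<sigma> x * C)"
    using assms(2) by (intro integrable_mult_left) auto
  show "AE x in lborel. norm (normal_density m \<sigma> x * g x) \<le> norm (normal_density m \<sigma> x * C)"
    using assms(3) by (intro always_eventually allI) (auto simp: abs_mult intro!: mult_left_mono order.trans[OF assms(3)])
qed simp

lemma std_normal_tail_eq_integral:
  "\<Psi> a = (\<integral>x. std_normal_density x * indicator {a<..} x \<partial>lborel)"
proof -
  have "\<Psi> a = (\<integral>x. indicator {a<..} x \<partial>density lborel std_normal_density)"
    unfolding std_normal_tail_def by simp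
  also have "\<dots> = (\<integral>x. std_normal_density x * indicator {a<..} x \<partial>lborel)"
    by (subst integral_density) auto
  finally show ?thesis .
qed

lemma std_normal_tail_nonneg: "0 \<le> \<Psi> a"
  unfolding std_normal_tail_def by simp

lemma normal_density_standardize:
  assumes "0 < \<sigma>"
  shows "normal_density m \<sigma> (m + \<sigma> * x) = std_normal_density x / \<sigma>"
  using assms by (simp add: normal_density_def power_mult_distrib field_simps real_sqrt_mult)

lemma integral_normal_density_greaterThan:
  assumes "0 < \<sigma>"
  shows "(\<integral>x. normal_density m \<sigma> x * indicator {a<..} x \<partial>lborel) = \<Psi> ((a - m) / \<sigma>)"
proof -
  have *: "indicator {a<..} (m + \<sigma> * x) = (indicator {(a - m) / \<sigma><..} x :: real)" for x
    using assms by (auto simp: indicator_def field_simps)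
  show ?thesis
    using assms
    by (subst lborel_integral_real_affine[where c=\<sigma> and t=m])
       (simp_all add: normal_density_standardize std_normal_tail_eq_integral *)
qed

text \<open>A substitution with negative slope reverses the half-line, so the lower tail becomes a
  value of \<Psi> itself and not of its complement.\<close>

lemma integral_normal_density_lessThan:
  assumes "0 < \<sigma>"
  shows "(\<integral>x. normal_density m \<sigma> x * indicator {..<a} x \<partial>lborel) = \<Psi> ((m - a) / \<sigma>)"
proof -
  have *: "indicator {..<a} (m + - \<sigma> * x) = (indicator {(m - a) / \<sigma><..} x :: real)" for x
    using assms by (auto simp: indicator_def field_simps)
  have **: "normal_density m \<sigma> (m + - \<sigma> * x) = std_normal_density x / \<sigma>" for x
    using normal_density_standardize[OF assms, of m "-x"] by (simp add: std_normal_density_def)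
  have "(\<integral>x. normal_density m \<sigma> x * indicator {..<a} x \<partial>lborel)
     = \<bar>-\<sigma>\<bar> * (\<integral>x. normal_density m \<sigma> (m + - \<sigma> * x) * indicator {..<a} (m + - \<sigma> * x) \<partial>lborel)"
    using assms by (subst lborel_integral_real_affine[where c="-\<sigma>" and t=m]) auto
  then show ?thesis
    unfolding * ** using assms by (simp add: std_normal_tail_eq_integral)
qed

section \<open>Derivatives of the normal density and tail\<close>

lemma continuous_std_normal_density: "continuous_on A std_normal_density"
  unfolding std_normal_density_def by (intro continuous_intros) auto

text \<open>Near \<open>x\<close> the tail differs from a constant by an integral over a compact
  interval, to which the fundamental theorem of calculus applies.\<close>

lemma DERIV_std_normal_tail: "(\<Psi> has_real_derivative - std_normal_density x) (at x)"
proof -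
  let ?a = "x - 1" and ?b = "x + 1"
  have eq: "\<Psi> y = \<Psi> ?a - integral {?a..y} std_normal_density" if "y \<in> {?a..?b}" for y
  proof -
    have "set_integrable lborel {?a..y} std_normal_density"
      by (intro borel_integrable_atLeastAtMost' continuous_std_normal_density)
    from set_borel_integral_eq_integral(2)[OF this]
    have I: "integral {?a..y} std_normal_density = (\<integral>z. std_normal_density z * indicator {?a..y} z \<partial>lborel)"
      by (simp add: set_lebesgue_integral_def mult.commute)
    have "integral {?a..y} std_normal_density + \<Psi> y
       = (\<integral>z. std_normal_density z * indicator {?a..y} z + std_normal_density z * indicator {y<..} z \<partial>lborel)"
      unfolding I std_normal_tail_eq_integral
      by (intro Bochner_Integration.integral_add[symmetric] integrable_normal_density_bounded_mult[where C=1])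
         (auto simp: indicator_def)
    also have "\<dots> = \<Psi> ?a"
      unfolding std_normal_tail_eq_integral
      \<comment> \<open>The integrands differ only at \<open>?a\<close>, which lies in the closed
        interval but not in the open half-line.\<close>
      by (rule integral_cong_AE)
         (use that AE_lborel_singleton[of ?a] in \<open>auto elim!: eventually_mono simp: indicator_def\<close>)
    finally show ?thesis by simp
  qed
  have "((\<lambda>y. \<Psi> ?a - integral {?a..y} std_normal_density) has_real_derivative - std_normal_density x) (at x within {?a..?b})"
    by (auto intro!: derivative_eq_intros integral_has_real_derivative continuous_std_normal_density)
  then have "(\<Psi> has_real_derivative - std_normal_density x) (at x within {?a..?b})"
    by (rule has_field_derivative_transform_within[where d=1]) (simp_all only: eq[symmetric], auto)
  then show ?thesis
    by (simp add: at_within_Icc_at)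
qed

lemma DERIV_std_normal_density:
  "(std_normal_density has_real_derivative - x * std_normal_density x) (at x)"
  unfolding std_normal_density_def[abs_def]
  by (rule derivative_eq_intros refl | simp)+

lemmas std_normal_derivs [derivative_intros] =
  DERIV_std_normal_tail[THEN DERIV_chain2] DERIV_std_normal_density[THEN DERIV_chain2]

section \<open>Laplace asymptotics of half-line integrals against a Gaussian weight\<close>

lemma has_bochner_integral_power_exp:
  "has_bochner_integral lborel (\<lambda>x::real. indicator {0<..} x * (x ^ k * exp (- x))) (fact k)"
proof (rule has_bochner_integral_nn_integral)
  have "(\<integral>\<^sup>+x. ennreal (indicator {0<..} x * (x ^ k * exp (- x))) \<partial>lborel)
      = (\<integral>\<^sup>+x. ennreal (x^k * exp (-x)) * indicator {0 ..} x \<partial>lborel)"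
    by (rule nn_integral_cong_AE)
       (use AE_lborel_singleton[of 0] in \<open>auto elim!: eventually_mono simp: indicator_def\<close>)
  then show "(\<integral>\<^sup>+x. ennreal (indicator {0<..} x * (x ^ k * exp (- x))) \<partial>lborel) = ennreal (fact k)"
    unfolding nn_intergal_power_times_exp_Ici by (simp add: ennreal_of_nat_eq_real_of_nat)
qed (auto simp: indicator_def)

text \<open>Watson's lemma for Gaussian weights: the substitution \<open>z = \<sigma>\<^sup>2 w / a\<close> turns
  \<open>normal_density 0 \<sigma> (a + z)\<close> into \<open>normal_density 0 \<sigma> a * exp (- w - \<sigma>\<^sup>2 w\<^sup>2 / (2 a\<^sup>2))\<close>.\<close>

lemma gaussian_tail_integral_asymptotics:
  fixes g :: "real \<Rightarrow> real"
  assumes [measurable]: "g \<in> borel_measurable borel" and \<sigma>: "0 < \<sigma>"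
    and bound: "\<And>z. 0 < z \<Longrightarrow> \<bar>g z\<bar> \<le> C * z ^ p"
    and lim: "((\<lambda>z. g z / z ^ p) \<longlongrightarrow> L) (at_right 0)"
  shows "((\<lambda>a. (\<integral>z. indicator {0<..} z * g z * normal_density 0 \<sigma> (a + z) \<partial>lborel)
      * a ^ Suc p / normal_density 0 \<sigma> a) \<longlongrightarrow> L * fact p * \<sigma> ^ (2 * Suc p)) at_top"
proof -
  \<comment> \<open>The factor \<open>a ^ p\<close> stands next to \<open>g\<close> because
    \<open>g\<close> is evaluated at distance of order 1/a from 0, where it is of order 1 /
    \<open>a ^ p\<close>; the product converges.\<close>
  define s where "s a w = indicator {0<..} w * (g (\<sigma>\<^sup>2 * w / a) * a ^ p) * exp (- w - \<sigma>\<^sup>2 * w\<^sup>2 / (2 * a\<^sup>2)) * \<sigma>\<^sup>2" for a w :: real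
  have eq: "(\<integral>z. indicator {0<..} z * g z * normal_density 0 \<sigma> (a + z) \<partial>lborel)
      * a ^ Suc p / normal_density 0 \<sigma> a = (\<integral>w. s a w \<partial>lborel)" if "a > 0" for a
  proof -
    have e: "normal_density 0 \<sigma> (a + \<sigma>\<^sup>2 / a * w) = normal_density 0 \<sigma> a * exp (- w - \<sigma>\<^sup>2 * w\<^sup>2 / (2 * a\<^sup>2))" for w
    proof -
      have "- (a + \<sigma>\<^sup>2 / a * w)\<^sup>2 / (2 * \<sigma>\<^sup>2) = - a\<^sup>2 / (2 * \<sigma>\<^sup>2) + (- w - \<sigma>\<^sup>2 * w\<^sup>2 / (2 * a\<^sup>2))"
        using \<sigma> that by (simp add: field_simps power2_eq_square)
      then show ?thesis
        by (simp add: normal_density_def exp_add[symmetric])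
    qed
    have i: "indicator {0<..} (\<sigma>\<^sup>2 / a * w) = (indicator {0<..} w :: real)" for w
      using \<sigma> that by (auto simp: indicator_def zero_less_mult_iff zero_less_divide_iff)
    have I: "(\<integral>z. indicator {0<..} z * g z * normal_density 0 \<sigma> (a + z) \<partial>lborel)
       = \<sigma>\<^sup>2 / a * (\<integral>w. indicator {0<..} w * g (\<sigma>\<^sup>2 / a * w) * (normal_density 0 \<sigma> a * exp (- w - \<sigma>\<^sup>2 * w\<^sup>2 / (2 * a\<^sup>2))) \<partial>lborel)"
      using \<sigma> that by (subst lborel_integral_real_affine[where c="\<sigma>\<^sup>2 / a" and t=0]) (simp_all add: i e del: times_divide_eq_left)
    have "(\<integral>z. indicator {0<..} z * g z * normal_density 0 \<sigma> (a + z) \<partial>lborel) * a ^ Suc p / normal_density 0 \<sigma> a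
        = (\<integral>w. indicator {0<..} w * g (\<sigma>\<^sup>2 / a * w) * (normal_density 0 \<sigma> a * exp (- w - \<sigma>\<^sup>2 * w\<^sup>2 / (2 * a\<^sup>2))) \<partial>lborel)
          * (a ^ p * \<sigma>\<^sup>2 / normal_density 0 \<sigma> a)"
    proof -
      have "S / a * I * a ^ Suc p / n = I * (a ^ p * S / n)" for S I n :: real
        using that by simp
      then show ?thesis unfolding I .
    qed
    also have "\<dots> = (\<integral>w. s a w \<partial>lborel)"
    proof (rule trans[OF integral_mult_left_zero[symmetric]], rule Bochner_Integration.integral_cong[OF refl])
      have cancel: "i * g * (n * E) * (A * S / n) = i * (g * A) * E * S" if "n \<noteq> 0" for i g n E A S :: real
        using that by simp
      show "indicator {0<..} w * g (\<sigma>\<^sup>2 / a * w) * (normal_density 0 \<sigma> a * exp (- w - \<sigma>\<^sup>2 * w\<^sup>2 / (2 * a\<^sup>2)))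
          * (a ^ p * \<sigma>\<^sup>2 / normal_density 0 \<sigma> a) = s a w" for w
        unfolding s_def times_divide_eq_left by (rule cancel) (use normal_density_pos[OF \<sigma>, of 0 a] in simp)
    qed
    finally show ?thesis .
  qed
  have pw: "\<sigma> ^ (2 * Suc p) = (\<sigma>\<^sup>2) ^ p * \<sigma>\<^sup>2"
    by (simp only: power_mult power_Suc2)
  define f where "f w = indicator {0<..} w * (w ^ p * exp (- w)) * (L * \<sigma> ^ (2 * Suc p))" for w :: real
  \<comment> \<open>Dropping the quadratic term of the exponent only increases it, which leaves a
    dominating function free of \<open>a\<close>.\<close>
  have int: "integrable lborel (\<lambda>w::real. indicator {0<..} w * (w ^ p * exp (- w)) * (C * \<sigma> ^ (2 * Suc p)))"
    using has_bochner_integral_power_exp[of p] by (intro integrable_mult_left) (rule integrable.intros)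
  have "((\<lambda>a. \<integral>w. s a w \<partial>lborel) \<longlongrightarrow> (\<integral>w. f w \<partial>lborel)) at_top"
  proof (rule integral_dominated_convergence_at_top[OF _ _ int])
    show "s a \<in> borel_measurable lborel" for a unfolding s_def[abs_def] by measurable
    show "f \<in> borel_measurable lborel" unfolding f_def[abs_def] by measurable
    show "AE w in lborel. ((\<lambda>a. s a w) \<longlongrightarrow> f w) at_top"
    proof (intro always_eventually allI)
      fix w :: real
      show "((\<lambda>a. s a w) \<longlongrightarrow> f w) at_top"
      proof (cases "w > 0")
        case True
        have *: "filterlim (\<lambda>a. \<sigma>\<^sup>2 * w / a) (at_right 0) at_top"
          using \<sigma> True by real_asymp
        have e: "((\<lambda>a. exp (- w - \<sigma>\<^sup>2 * w\<^sup>2 / (2 * a\<^sup>2))) \<longlongrightarrow> exp (-w)) at_top"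
          by real_asymp
        have "((\<lambda>a. g (\<sigma>\<^sup>2 * w / a) / (\<sigma>\<^sup>2 * w / a) ^ p * (\<sigma>\<^sup>2 * w) ^ p * exp (- w - \<sigma>\<^sup>2 * w\<^sup>2 / (2 * a\<^sup>2)) * \<sigma>\<^sup>2)
             \<longlongrightarrow> L * (\<sigma>\<^sup>2 * w) ^ p * exp (-w) * \<sigma>\<^sup>2) at_top"
          by (intro tendsto_intros filterlim_compose[OF lim *] e)
        moreover have "eventually (\<lambda>a. g (\<sigma>\<^sup>2 * w / a) / (\<sigma>\<^sup>2 * w / a) ^ p * (\<sigma>\<^sup>2 * w) ^ p * exp (- w - \<sigma>\<^sup>2 * w\<^sup>2 / (2 * a\<^sup>2)) * \<sigma>\<^sup>2 = s a w) at_top"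
          using eventually_gt_at_top[of 0]
          by eventually_elim (use True \<sigma> in \<open>simp add: s_def power_divide power_mult_distrib\<close>)
        moreover have "L * (\<sigma>\<^sup>2 * w) ^ p * exp (-w) * \<sigma>\<^sup>2 = f w"
          using True unfolding f_def pw by (simp add: power_mult_distrib)
        ultimately show ?thesis
          by (simp add: tendsto_cong)
      qed (simp add: s_def f_def)
    qed
    show "\<forall>\<^sub>F a in at_top. AE w in lborel. norm (s a w) \<le> indicator {0<..} w * (w ^ p * exp (- w)) * (C * \<sigma> ^ (2 * Suc p))"
      using eventually_gt_at_top[of 0]
    proof (eventually_elim, intro always_eventually allI)
      fix a w :: real assume a: "a > 0"
      show "norm (s a w) \<le> indicator {0<..} w * (w ^ p * exp (- w)) * (C * \<sigma> ^ (2 * Suc p))"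
      proof (cases "w > 0")
        case True
        have "\<bar>g (\<sigma>\<^sup>2 * w / a)\<bar> * a ^ p \<le> (C * (\<sigma>\<^sup>2 * w / a) ^ p) * a ^ p"
          using a \<sigma> True by (intro mult_right_mono bound) auto
        also have "\<dots> = C * (\<sigma>\<^sup>2 * w) ^ p"
          using a by (simp add: power_divide)
        finally have 1: "\<bar>g (\<sigma>\<^sup>2 * w / a)\<bar> * a ^ p \<le> C * (\<sigma>\<^sup>2 * w) ^ p" .
        have 2: "exp (- w - \<sigma>\<^sup>2 * w\<^sup>2 / (2 * a\<^sup>2)) \<le> exp (-w)"
          by simp
        have "norm (s a w) = (\<bar>g (\<sigma>\<^sup>2 * w / a)\<bar> * a ^ p) * exp (- w - \<sigma>\<^sup>2 * w\<^sup>2 / (2 * a\<^sup>2)) * \<sigma>\<^sup>2"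
          using a True by (simp add: s_def abs_mult)
        also have "\<dots> \<le> (C * (\<sigma>\<^sup>2 * w) ^ p) * exp (-w) * \<sigma>\<^sup>2"
          using a by (intro mult_right_mono mult_mono 1 2 order.trans[OF _ 1]) auto
        also have "\<dots> = indicator {0<..} w * (w ^ p * exp (- w)) * (C * \<sigma> ^ (2 * Suc p))"
          using True unfolding pw by (simp add: power_mult_distrib)
        finally show ?thesis .
      qed (simp add: s_def)
    qed
  qed
  also have "(\<integral>w. f w \<partial>lborel) = L * fact p * \<sigma> ^ (2 * Suc p)"
    unfolding f_def using has_bochner_integral_power_exp[of p]
    by (simp add: has_bochner_integral_integral_eq)
  finally show ?thesis
    by (rule Lim_transform_eventually) (use eventually_gt_at_top[of 0] in eventually_elim, simp only: eq)
qed

text \<open>The Mills ratio, as the case of constant weight 1 and exponent 0.\<close>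

lemma std_normal_tail_asymptotics:
  "((\<lambda>a. \<Psi> a * a / std_normal_density a) \<longlongrightarrow> 1) at_top"
proof -
  have eq: "(\<integral>z. indicator {0<..} z * 1 * std_normal_density (a + z) \<partial>lborel) = \<Psi> a" for a
  proof -
    have "indicator {a<..} (a + z) = (indicator {0<..} z :: real)" for z
      by (auto simp: indicator_def)
    then show ?thesis
      unfolding std_normal_tail_eq_integral
      by (subst lborel_integral_real_affine[where c=1 and t=a]) (simp_all add: mult.commute)
  qed
  show ?thesis
    using gaussian_tail_integral_asymptotics[of "\<lambda>_. 1" 1 1 0 1] by (simp add: eq[simplified])
qed

text \<open>The difference \<open>?G\<close> has the negative derivative \<open>- \<Psi>\<close> and
  tends to 0 at infinity, so it is positive on the whole line.\<close>

lemma mult_std_normal_tail_less: "x * \<Psi> x < std_normal_density x"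
proof -
  let ?G = "\<lambda>x. std_normal_density x - x * \<Psi> x"
  have "(std_normal_density \<longlongrightarrow> 0) at_top"
    unfolding std_normal_density_def by real_asymp
  from tendsto_mult[OF std_normal_tail_asymptotics this]
  have "((\<lambda>x. x * \<Psi> x) \<longlongrightarrow> 0) at_top"
    by (simp add: std_normal_density_def mult.commute)
  with \<open>(std_normal_density \<longlongrightarrow> 0) at_top\<close> have lim: "(?G \<longlongrightarrow> 0) at_top"
    using tendsto_diff by fastforce
  have pos: "0 < \<Psi> y" for y
  proof -
    \<comment> \<open>A zero of the tail would make it vanish on a whole half-line, against the
      Mills limit 1.\<close>
    have "\<Psi> y \<noteq> 0"
    proof
      assume "\<Psi> y = 0"
      then have z: "\<Psi> z = 0" if "z \<ge> y" for z
      proof -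
        have "\<Psi> z \<le> \<Psi> y" unfolding std_normal_tail_def
        proof -
          interpret prob_space "density lborel std_normal_density"
            by (rule prob_space_normal_density) simp
          show "prob {z<..} \<le> prob {y<..}" using that by (intro finite_measure_mono) auto
        qed
        with \<open>\<Psi> y = 0\<close> std_normal_tail_nonneg[of z] show ?thesis by simp
      qed
      have "eventually (\<lambda>a. \<Psi> a * a / std_normal_density a = 0) at_top"
        using eventually_ge_at_top[of y] by eventually_elim (simp add: z)
      then have "((\<lambda>a. \<Psi> a * a / std_normal_density a) \<longlongrightarrow> 0) at_top"
        by (rule tendsto_eventually)
      with std_normal_tail_asymptotics show False
        using tendsto_unique trivial_limit_at_top_linorder by (metis zero_neq_one)
    qed
    with std_normal_tail_nonneg[of y] show ?thesis by simp
  qed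
  have "0 < ?G x"
  proof (rule DERIV_neg_imp_decreasing_at_top[OF _ lim])
    show "\<exists>d. (?G has_real_derivative d) (at y) \<and> d < 0" for y
      by (rule exI[of _ "- \<Psi> y"]) (auto intro!: derivative_eq_intros pos)
  qed
  then show ?thesis by simp
qed

text \<open>With q = c sqrt y the constant is 2 / sqrt y times the difference of the density at q
  and q \<Psi>(q), so the strict Mills bound decides the sign.\<close>

lemma K_const_pos:
  assumes "0 < y"
  shows "0 < K_const c y"
proof -
  have "2 / sqrt y * (c * sqrt y * \<Psi> (c * sqrt y)) < 2 / sqrt y * std_normal_density (c * sqrt y)"
    using assms by (intro mult_strict_left_mono mult_std_normal_tail_less) auto
  then show ?thesis
    using assms by (simp add: K_const_def field_simps)
qed

section \<open>Survival above zero under negative drift\<close>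

text \<open>For \<open>x \<ge> 0\<close> this is the probability that Brownian motion with drift \<open>-c\<close> started
  at \<open>x\<close> stays positive up to time \<open>t\<close>, with the closed formula continued to negative \<open>x\<close>.\<close>

definition surv :: "real \<Rightarrow> real \<Rightarrow> real \<Rightarrow> real" where
  "surv c t x = \<Psi> ((c * t - x) / sqrt t) - exp (2 * c * x) * \<Psi> ((x + c * t) / sqrt t)"

text \<open>Both half-lines are open, so the value at the mirror is 0 and the weak sign inequalities
  hold there in both directions.\<close>

definition reflected_indicator :: "real \<Rightarrow> real \<Rightarrow> real" where
  "reflected_indicator c x = indicator {0<..} x - exp (2 * c * x) * indicator {..<0} x"

text \<open>Mirroring exchanges the two tails and the exponential factors cancel. This transfers the
  sign from the positive to the negative half-line.\<close>

lemma surv_minus: "surv c t (- x) = - exp (- 2 * c * x) * surv c t x"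
proof -
  have "exp (- 2 * c * x) * exp (2 * c * x) = 1"
    by (simp flip: exp_add)
  then have "exp (- 2 * c * x) * (exp (2 * c * x) * y) = y" for y
    by (simp flip: mult.assoc)
  then show ?thesis
    unfolding surv_def by (simp add: right_diff_distrib add.commute)
qed

lemma surv_0 [simp]: "surv c t 0 = 0"
  by (simp add: surv_def)

lemma DERIV_surv:
  assumes t: "0 < t"
  shows "(surv c t has_real_derivative
    2 * exp (2 * c * x) * (std_normal_density ((x + c * t) / sqrt t) / sqrt t - c * \<Psi> ((x + c * t) / sqrt t))) (at x)"
proof -
  \<comment> \<open>The weight \<open>exp (2 * c * x)\<close> absorbs exactly the difference of the
    two squares, so both tails contribute the same density term; hence the factor 2.\<close>
  have "(c * t - x)\<^sup>2 / t = (x + c * t)\<^sup>2 / t - 4 * c * x"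
    using t by (simp add: power2_eq_square field_simps)
  then have e: "std_normal_density ((c * t - x) / sqrt t) = exp (2 * c * x) * std_normal_density ((x + c * t) / sqrt t)"
    using t by (simp add: std_normal_density_def power_divide exp_add[symmetric] field_simps)
  show ?thesis
    unfolding surv_def[abs_def] using t
    by (auto intro!: derivative_eq_intros simp: e field_simps)
qed

text \<open>\<open>surv\<close> vanishes at 0 and does not decrease to the right of it: there
  \<open>?q / sqrt t\<close> is at least \<open>c\<close>, and the Mills bound at \<open>?q\<close>
  gives the sign of the derivative.\<close>

lemma surv_nonneg:
  assumes t: "0 < t" and x: "0 \<le> x"
  shows "0 \<le> surv c t x"
proof -
  have "surv c t 0 \<le> surv c t x"
  proof (rule DERIV_nonneg_imp_nondecreasing[OF x])
    fix z :: real assume z: "0 \<le> z" "z \<le> x"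
    let ?q = "(z + c * t) / sqrt t"
    have "c \<le> ?q / sqrt t"
      using t z by (simp add: field_simps)
    then have "c * \<Psi> ?q \<le> ?q / sqrt t * \<Psi> ?q"
      by (intro mult_right_mono std_normal_tail_nonneg)
    also have "\<dots> = (?q * \<Psi> ?q) / sqrt t" by simp
    also have "\<dots> \<le> std_normal_density ?q / sqrt t"
      using t mult_std_normal_tail_less[of ?q] by (intro divide_right_mono less_imp_le) auto
    finally have "0 \<le> 2 * exp (2 * c * z) * (std_normal_density ?q / sqrt t - c * \<Psi> ?q)"
      by simp
    then show "\<exists>d. (surv c t has_real_derivative d) (at z) \<and> 0 \<le> d"
      using DERIV_surv[OF t] by blast
  qed
  then show ?thesis by simp
qed

lemma surv_nonpos:
  assumes t: "0 < t" and x: "x \<le> 0"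
  shows "surv c t x \<le> 0"
  using surv_minus[of c t "-x"] surv_nonneg[OF t, of "-x" c] x by (simp add: mult_nonneg_nonneg)

lemma measurable_reflected_indicator [measurable]: "reflected_indicator c \<in> borel_measurable borel"
  unfolding reflected_indicator_def[abs_def] by measurable

lemma abs_reflected_indicator_le: "0 < c \<Longrightarrow> \<bar>reflected_indicator c x\<bar> \<le> 1"
  by (auto simp: reflected_indicator_def indicator_def mult_nonneg_nonpos mult_pos_neg)

lemma measurable_surv [measurable]: "surv c t \<in> borel_measurable borel"
proof -
  have [measurable]: "\<Psi> \<in> borel_measurable borel"
    by (intro borel_measurable_continuous_onI continuous_at_imp_continuous_on ballI)
       (rule DERIV_isCont[OF DERIV_std_normal_tail])
  show ?thesis unfolding surv_def[abs_def] by measurable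
qed

lemma integral_reflected_indicator:
  assumes t: "0 < t" and c: "0 < c"
  shows "(\<integral>w. normal_density 0 (sqrt t) w * reflected_indicator c (x + w - c * t) \<partial>lborel) = surv c t x"
proof -
  let ?n = "normal_density 0 (sqrt t)" and ?n2 = "normal_density (2 * c * t) (sqrt t)" and ?a = "c * t - x"
  \<comment> \<open>Completing the square: the tilt moves the mean from 0 to
    \<open>2 * c * t\<close>, and the normalising factors in \<open>t\<close> cancel.\<close>
  have e: "?n w * exp (2 * c * (x + w - c * t)) = exp (2 * c * x) * normal_density (2 * c * t) (sqrt t) w" for w
  proof -
    have "- w\<^sup>2 / (2 * t) + 2 * c * (x + w - c * t) = 2 * c * x + - (w - 2 * c * t)\<^sup>2 / (2 * t)"
      using t by (simp add: field_simps power2_eq_square)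
    then have "exp (- w\<^sup>2 / (2 * t)) * exp (2 * c * (x + w - c * t)) = exp (2 * c * x) * exp (- (w - 2 * c * t)\<^sup>2 / (2 * t))"
      by (simp only: exp_add[symmetric])
    then show ?thesis
      using t by (simp add: normal_density_def field_simps)
  qed
  have "(\<integral>w. ?n w * reflected_indicator c (x + w - c * t) \<partial>lborel)
     = (\<integral>w. ?n w * indicator {?a<..} w - exp (2 * c * x) * (normal_density (2 * c * t) (sqrt t) w * indicator {..<?a} w) \<partial>lborel)"
  proof (rule Bochner_Integration.integral_cong[OF refl])
    fix w
    have i: "indicator {0<..} (x + w - c * t) = (indicator {?a<..} w :: real)" "indicator {..<0} (x + w - c * t) = (indicator {..<?a} w :: real)"
      by (auto simp: indicator_def)
    show "?n w * reflected_indicator c (x + w - c * t) = ?n w * indicator {?a<..} w - exp (2 * c * x) * (?n2 w * indicator {..<?a} w)"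
      unfolding reflected_indicator_def i mult.assoc[symmetric] e[symmetric] by (simp add: algebra_simps)
  qed
  also have "\<dots> = (\<integral>w. ?n w * indicator {?a<..} w \<partial>lborel) - exp (2 * c * x) * (\<integral>w. ?n2 w * indicator {..<?a} w \<partial>lborel)"
    using t
    by (subst Bochner_Integration.integral_diff)
       (auto intro!: integrable_mult_right integrable_normal_density_bounded_mult[where C=1]
          simp: indicator_def simp del: indicator_simps)
  also have "\<dots> = \<Psi> (?a / sqrt t) - exp (2 * c * x) * \<Psi> ((2 * c * t - ?a) / sqrt t)"
    using t by (simp only: integral_normal_density_lessThan integral_normal_density_greaterThan real_sqrt_gt_0_iff diff_0_right)
  also have "\<dots> = surv c t x"
    by (simp add: surv_def algebra_simps)
  finally show ?thesis .
qed

text \<open>The exponential factor in the closed formula is harmless, because the whole is a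
  Gaussian mean of values in [-1, 1].\<close>

lemma abs_surv_le_1:
  assumes t: "0 < t" and c: "0 < c"
  shows "\<bar>surv c t x\<bar> \<le> 1"
proof -
  have "\<bar>surv c t x\<bar> \<le> (\<integral>w. \<bar>normal_density 0 (sqrt t) w * reflected_indicator c (x + w - c * t)\<bar> \<partial>lborel)"
    unfolding integral_reflected_indicator[OF assms, symmetric] by (rule integral_abs_bound)
  also have "\<dots> \<le> (\<integral>w. normal_density 0 (sqrt t) w \<partial>lborel)"
    using t c
    by (intro integral_mono integrable_abs integrable_normal_density_bounded_mult[where C=1])
       (auto simp: abs_mult intro!: mult_left_le abs_reflected_indicator_le)
  finally show ?thesis using t by simp
qed

lemma surv_asymptotics:
  assumes t: "0 < t" and c: "0 < c"
  shows "((\<lambda>z. surv c t z / z) \<longlongrightarrow> K_const c t) (at_right 0)"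
    and "\<exists>C. \<forall>z>0. \<bar>surv c t z\<bar> \<le> C * z"
proof -
  have "c * t / sqrt t = c * sqrt t"
    using t by (simp add: real_div_sqrt flip: times_divide_eq_right)
  then have "((\<lambda>z. surv c t z / z) \<longlongrightarrow> K_const c t) (at 0)"
    using DERIV_surv[OF t, of c 0] t
    by (simp add: has_field_derivative_iff K_const_def algebra_simps)
  then show lim: "((\<lambda>z. surv c t z / z) \<longlongrightarrow> K_const c t) (at_right 0)"
    by (rule tendsto_mono[rotated]) (simp add: at_le)
  then have "eventually (\<lambda>z. surv c t z / z < K_const c t + 1) (at_right 0)"
    by (rule order_tendstoD) simp
  then obtain \<delta> where \<delta>: "0 < \<delta>" "\<And>z. 0 < z \<Longrightarrow> z < \<delta> \<Longrightarrow> surv c t z / z < K_const c t + 1"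
    by (auto simp: eventually_at_right_field)
  show "\<exists>C. \<forall>z>0. \<bar>surv c t z\<bar> \<le> C * z"
  proof (intro exI allI impI)
    fix z :: real assume z: "0 < z"
    \<comment> \<open>Below \<open>\<delta>\<close> any slope above the derivative at 0 works, here
      larger by 1; beyond \<open>\<delta>\<close> the bound 1 is at most
      \<open>z / \<delta>\<close>.\<close>
    show "\<bar>surv c t z\<bar> \<le> max (K_const c t + 1) (1 / \<delta>) * z"
    proof (cases "z < \<delta>")
      case True
      have "\<bar>surv c t z\<bar> \<le> (K_const c t + 1) * z"
        using \<delta>(2)[OF z True] z surv_nonneg[OF t, of z c] by (simp add: field_simps)
      also have "\<dots> \<le> max (K_const c t + 1) (1 / \<delta>) * z"
        using z by (intro mult_right_mono) auto
      finally show ?thesis .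
    next
      case False
      have "\<bar>surv c t z\<bar> \<le> 1"
        by (rule abs_surv_le_1[OF t c])
      also have "\<dots> \<le> 1 / \<delta> * z"
        using False \<delta>(1) by (simp add: field_simps)
      also have "\<dots> \<le> max (K_const c t + 1) (1 / \<delta>) * z"
        using z by (intro mult_right_mono) auto
      finally show ?thesis .
    qed
  qed
qed

section \<open>Reflection at the first passage of a time grid\<close>

text \<open>\<open>indep_var\<close> relates variables of one type only, so the increment enters as \<open>h (Z \<omega>)\<close> with
  \<open>Z\<close> of the type of the conditioning variable.\<close>

lemma (in prob_space) expectation_indep_normal:
  fixes g :: "'b \<times> real \<Rightarrow> real" and V Z :: "'a \<Rightarrow> 'b"
  assumes ind: "indep_var N V N' Z" and h [measurable]: "h \<in> borel_measurable N'"
    and D: "distributed M lborel (\<lambda>\<omega>. h (Z \<omega>)) (normal_density 0 \<sigma>)"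
    and g [measurable]: "g \<in> borel_measurable (N \<Otimes>\<^sub>M borel)"
    and bound: "\<And>p. \<bar>g p\<bar> \<le> C"
  shows "expectation (\<lambda>\<omega>. g (V \<omega>, h (Z \<omega>))) =
    expectation (\<lambda>\<omega>. \<integral>w. normal_density 0 \<sigma> w * g (V \<omega>, w) \<partial>lborel)"
proof -
  have V [measurable]: "random_variable N V" and [measurable]: "random_variable N' Z"
    and eq: "distr M N V \<Otimes>\<^sub>M distr M N' Z = distr M (N \<Otimes>\<^sub>M N') (\<lambda>\<omega>. (V \<omega>, Z \<omega>))"
    using ind unfolding indep_var_distribution_eq by auto
  interpret PV: prob_space "distr M N V" by (rule prob_space_distr) simp
  interpret PD: prob_space "distr M N' Z" by (rule prob_space_distr) simp
  interpret VZ: pair_prob_space "distr M N V" "distr M N' Z" ..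
  let ?g = "\<lambda>(v, z). g (v, h z)"
  have inner: "(\<integral>z. g (v, h z) \<partial>distr M N' Z) = (\<integral>w. normal_density 0 \<sigma> w * g (v, w) \<partial>lborel)"
    if v [measurable]: "v \<in> space N" for v
    using distributed_integral[OF D, of "\<lambda>w. g (v, w)"] by (simp add: integral_distr)
  have meas: "(\<lambda>v. \<integral>w. normal_density 0 \<sigma> w * g (v, w) \<partial>lborel) \<in> borel_measurable N"
    by (rule lborel.borel_measurable_lebesgue_integral) measurable
  have int: "integrable (distr M N V \<Otimes>\<^sub>M distr M N' Z) ?g"
    using bound by (intro VZ.P.integrable_const_bound[where B=C]) auto
  have "expectation (\<lambda>\<omega>. g (V \<omega>, h (Z \<omega>))) = (\<integral>p. ?g p \<partial>(distr M N V \<Otimes>\<^sub>M distr M N' Z))"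
    unfolding eq by (simp add: integral_distr)
  also have "\<dots> = (\<integral>v. (\<integral>z. g (v, h z) \<partial>distr M N' Z) \<partial>distr M N V)"
    using VZ.integral_fst'[OF int] by simp
  also have "\<dots> = (\<integral>v. (\<integral>w. normal_density 0 \<sigma> w * g (v, w) \<partial>lborel) \<partial>distr M N V)"
    by (rule Bochner_Integration.integral_cong) (auto simp: inner)
  also have "\<dots> = expectation (\<lambda>\<omega>. \<integral>w. normal_density 0 \<sigma> w * g (V \<omega>, w) \<partial>lborel)"
    using meas by (simp add: integral_distr)
  finally show ?thesis .
qed

text \<open>A path above \<open>u\<close> at index 0 either stays above or has a unique first index
  at or below \<open>u\<close>, which is at least 1. For any other path both sides are 0.\<close>

lemma first_passage_decomposition:
  fixes x :: "nat \<Rightarrow> real"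
  shows "of_bool (u < x 0) = (of_bool (\<forall>i\<le>n. u < x i) :: real)
    + (\<Sum>k=1..n. of_bool ((\<forall>i<k. u < x i) \<and> x k \<le> u))"
proof (induction n)
  case (Suc n)
  have "(\<forall>i\<le>Suc n. u < x i) \<longleftrightarrow> (\<forall>i\<le>n. u < x i) \<and> u < x (Suc n)"
    by (auto simp: le_Suc_eq)
  with Suc show ?case
    by (auto simp: less_Suc_eq_le not_le)
qed simp

text \<open>At most one summand is nonzero, and for it the step into index \<open>k\<close> starts
  above \<open>u\<close> and ends below \<open>b\<close>.\<close>

lemma first_passage_overshoot:
  fixes x :: "nat \<Rightarrow> real"
  shows "(\<Sum>k=1..n. of_bool ((\<forall>i<k. u < x i) \<and> x k \<le> u) * of_bool (x k < b))
    \<le> (of_bool (\<exists>j<n. u - b < \<bar>x (Suc j) - x j\<bar>) :: real)"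
proof (cases "\<exists>j<n. u - b < \<bar>x (Suc j) - x j\<bar>")
  case True
  have "(\<Sum>k=1..n. of_bool ((\<forall>i<k. u < x i) \<and> x k \<le> u) * of_bool (x k < b))
      \<le> (\<Sum>k=1..n. of_bool ((\<forall>i<k. u < x i) \<and> x k \<le> u) :: real)"
    by (intro sum_mono) auto
  also have "\<dots> = of_bool (u < x 0) - of_bool (\<forall>i\<le>n. u < x i)"
    using first_passage_decomposition[of u x n] by simp
  also have "\<dots> \<le> 1" by simp
  finally show ?thesis using True by simp
next
  case False
  have "of_bool ((\<forall>i<k. u < x i) \<and> x k \<le> u) * of_bool (x k < b) = (0 :: real)" if "k \<in> {1..n}" for k
  proof -
    from that obtain j where j: "k = Suc j" "j < n" by (cases k) auto
    with False have "\<bar>x k - x j\<bar> \<le> u - b" by force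
    then show ?thesis using j by auto
  qed
  then have "(\<Sum>k=1..n. of_bool ((\<forall>i<k. u < x i) \<and> x k \<le> u) * of_bool (x k < b)) = (0 :: real)"
    by (intro sum.neutral) blast
  then show ?thesis by simp
qed

section \<open>The Markov property at grid times\<close>

context standard_brownian_motion
begin

text \<open>The initial value is 0 only almost surely; subtracting it makes the process a function
  of increments on every path.\<close>

definition drifted :: "real \<Rightarrow> real \<Rightarrow> 'a \<Rightarrow> real" where
  "drifted c t \<omega> = B t \<omega> - B 0 \<omega> - c * t"

lemma measurable_drifted [measurable]: "0 \<le> t \<Longrightarrow> drifted c t \<in> borel_measurable M"
  using random_variable_at[of t] random_variable_at[of 0] unfolding drifted_def[abs_def] by measurable

text \<open>The past values are partial sums of increments, so disjoint groups of independent
  increments give the claim.\<close>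

lemma indep_past_increment:
  fixes s :: "nat \<Rightarrow> real"
  assumes "0 < s 0" and s: "\<And>i. i < k \<Longrightarrow> s i < s (Suc i)" and "s k < T"
  shows "indep_var (PiM {..k} (\<lambda>_. borel)) (\<lambda>\<omega>. \<lambda>i\<in>{..k}. B (s i) \<omega> - B 0 \<omega>)
    (PiM {Suc k} (\<lambda>_. borel)) (\<lambda>\<omega>. \<lambda>i\<in>{Suc k}. B T \<omega> - B (s k) \<omega>)"
proof -
  \<comment> \<open>Time 0 is prepended and \<open>T\<close> appended: increments 0 to
    \<open>k\<close> make up the past, and increment \<open>Suc k\<close> is the one ending at
    \<open>T\<close>.\<close>
  define \<theta> where "\<theta> i = (if i = 0 then 0 else if i \<le> Suc k then s (i - 1) else T)" for i
  let ?D = "\<lambda>i \<omega>. B (\<theta> (Suc i)) \<omega> - B (\<theta> i) \<omega>"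
  have "indep_vars (\<lambda>_. borel) ?D {..<Suc (Suc k)}"
  proof (rule independent_increments)
    show "0 \<le> \<theta> 0" by (simp add: \<theta>_def)
    show "\<forall>i<Suc (Suc k). \<theta> i < \<theta> (Suc i)"
    proof (intro allI impI)
      fix i assume "i < Suc (Suc k)"
      then show "\<theta> i < \<theta> (Suc i)"
        using assms(1,3) s[of "i - 1"] by (cases i) (auto simp: \<theta>_def less_Suc_eq)
    qed
  qed
  from indep_var_restrict[OF this, of "{..k}" "{Suc k}"]
  have "indep_var (PiM {..k} (\<lambda>_. borel)) (\<lambda>\<omega>. \<lambda>i\<in>{..k}. ?D i \<omega>)
      (PiM {Suc k} (\<lambda>_. borel)) (\<lambda>\<omega>. \<lambda>i\<in>{Suc k}. ?D i \<omega>)" by (auto simp: subset_eq)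
  moreover have "(\<lambda>v. \<lambda>i\<in>{..k}. \<Sum>j<Suc i. v j) \<in> PiM {..k} (\<lambda>_. borel) \<rightarrow>\<^sub>M PiM {..k} (\<lambda>_. borel :: real measure)"
    by (intro measurable_restrict borel_measurable_sum measurable_component_singleton) auto
  ultimately have "indep_var (PiM {..k} (\<lambda>_. borel)) ((\<lambda>v. \<lambda>i\<in>{..k}. \<Sum>j<Suc i. v j) \<circ> (\<lambda>\<omega>. \<lambda>i\<in>{..k}. ?D i \<omega>))
      (PiM {Suc k} (\<lambda>_. borel)) ((\<lambda>v. v) \<circ> (\<lambda>\<omega>. \<lambda>i\<in>{Suc k}. ?D i \<omega>))"
    by (rule indep_var_compose) simp
  also have "(\<lambda>v. \<lambda>i\<in>{..k}. \<Sum>j<Suc i. v j) \<circ> (\<lambda>\<omega>. \<lambda>i\<in>{..k}. ?D i \<omega>) = (\<lambda>\<omega>. \<lambda>i\<in>{..k}. B (s i) \<omega> - B 0 \<omega>)"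
  proof (rule ext, unfold o_def, rule restrict_ext)
    fix \<omega> i assume i: "i \<in> {..k}"
    have "(\<Sum>j<Suc i. (\<lambda>i\<in>{..k}. ?D i \<omega>) j) = (\<Sum>j<Suc i. ?D j \<omega>)"
      using i by (intro sum.cong) auto
    also have "\<dots> = B (\<theta> (Suc i)) \<omega> - B (\<theta> 0) \<omega>"
      by (rule sum_lessThan_telescope)
    finally show "(\<Sum>j<Suc i. (\<lambda>i\<in>{..k}. ?D i \<omega>) j) = B (s i) \<omega> - B 0 \<omega>"
      using i by (simp add: \<theta>_def)
  qed
  also have "(\<lambda>v. v) \<circ> (\<lambda>\<omega>. \<lambda>i\<in>{Suc k}. ?D i \<omega>) = (\<lambda>\<omega>. \<lambda>i\<in>{Suc k}. B T \<omega> - B (s k) \<omega>)"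
    by (auto simp: \<theta>_def fun_eq_iff)
  finally show ?thesis .
qed

text \<open>The Markov property at the fixed time \<open>s k\<close>: with the past frozen, the
  average over the last increment is \<open>surv\<close> for the remaining time.\<close>

lemma expectation_reflected_given_past:
  fixes s :: "nat \<Rightarrow> real" and A :: "(nat \<Rightarrow> real) set"
  assumes "0 < s 0" and s: "\<And>i. i < k \<Longrightarrow> s i < s (Suc i)" and "s k < T" and c: "0 < c"
    and A [measurable]: "A \<inter> space (PiM {..k} (\<lambda>_. borel)) \<in> sets (PiM {..k} (\<lambda>_. borel))"
  shows "expectation (\<lambda>\<omega>. indicator A (\<lambda>i\<in>{..k}. B (s i) \<omega> - B 0 \<omega>) * reflected_indicator c (drifted c T \<omega> - b))
    = expectation (\<lambda>\<omega>. indicator A (\<lambda>i\<in>{..k}. B (s i) \<omega> - B 0 \<omega>) * surv c (T - s k) (drifted c (s k) \<omega> - b))"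
proof -
  let ?N = "PiM {..k} (\<lambda>_. borel) :: (nat \<Rightarrow> real) measure"
  let ?V = "\<lambda>\<omega>. \<lambda>i\<in>{..k}. B (s i) \<omega> - B 0 \<omega>"
  define g where "g = (\<lambda>(v, w). indicator (A \<inter> space ?N) v * reflected_indicator c ((v k - c * s k - b) + w - c * (T - s k)))"
  have "0 \<le> s k"
    using s
  proof (induction k)
    case (Suc k)
    then show ?case by (meson less_SucI less_eq_real_def lessI order_le_less_trans)
  qed (use assms(1) in simp)
  have D: "distributed M lborel (\<lambda>\<omega>. B T \<omega> - B (s k) \<omega>) (normal_density 0 (sqrt (T - s k)))"
    by (rule normal_increments) (use \<open>0 \<le> s k\<close> assms(3) in auto)
  have [measurable]: "(\<lambda>v. v k) \<in> borel_measurable ?N"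
    by (rule measurable_component_singleton) simp
  have g: "g \<in> borel_measurable (?N \<Otimes>\<^sub>M borel)"
    unfolding g_def case_prod_beta by measurable
  have V: "?V \<omega> \<in> space ?N" for \<omega> by (simp add: space_PiM)
  have bound: "\<bar>g p\<bar> \<le> 1" for p
    using abs_reflected_indicator_le[OF c] by (auto simp: g_def indicator_def split: prod.split)
  have h: "(\<lambda>z. z (Suc k)) \<in> borel_measurable (PiM {Suc k} (\<lambda>_. borel))"
    by (rule measurable_component_singleton) simp
  have "expectation (\<lambda>\<omega>. g (?V \<omega>, B T \<omega> - B (s k) \<omega>)) =
    expectation (\<lambda>\<omega>. \<integral>w. normal_density 0 (sqrt (T - s k)) w * g (?V \<omega>, w) \<partial>lborel)"
    using expectation_indep_normal[OF indep_past_increment[OF assms(1) s assms(3)] h _ g bound] D by simp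
  also have "(\<lambda>\<omega>. g (?V \<omega>, B T \<omega> - B (s k) \<omega>)) = (\<lambda>\<omega>. indicator A (?V \<omega>) * reflected_indicator c (drifted c T \<omega> - b))"
    using V by (auto simp: g_def drifted_def indicator_def algebra_simps)
  also have "(\<lambda>\<omega>. \<integral>w. normal_density 0 (sqrt (T - s k)) w * g (?V \<omega>, w) \<partial>lborel)
     = (\<lambda>\<omega>. indicator A (?V \<omega>) * surv c (T - s k) (drifted c (s k) \<omega> - b))"
  proof
    fix \<omega>
    show "(\<integral>w. normal_density 0 (sqrt (T - s k)) w * g (?V \<omega>, w) \<partial>lborel)
     = indicator A (?V \<omega>) * surv c (T - s k) (drifted c (s k) \<omega> - b)"
      using V[of \<omega>] integral_reflected_indicator[of "T - s k" c "drifted c (s k) \<omega> - b"] assms(3) c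
      by (cases "?V \<omega> \<in> A") (simp_all add: g_def drifted_def)
  qed
  finally show ?thesis .
qed

text \<open>The level \<open>u\<close> and the mirror \<open>b\<close> are kept apart: they coincide
  for the lower bound, while the upper bound needs \<open>b\<close> below the level.\<close>

definition reflected_mean :: "real \<Rightarrow> real \<Rightarrow> real \<Rightarrow> real \<Rightarrow> real \<Rightarrow> real" where
  "reflected_mean c S T b u =
    expectation (\<lambda>\<omega>. of_bool (u < drifted c S \<omega>) * reflected_indicator c (drifted c T \<omega> - b))"

text \<open>A first passage at index \<open>k\<close> is decided by the values up to
  \<open>s k\<close>, so conditioning at fixed times handles a stopping time.\<close>

lemma expectation_first_passage:
  fixes s :: "nat \<Rightarrow> real"
  assumes "0 < s 0" and s: "\<And>i. i < k \<Longrightarrow> s i < s (Suc i)" and "s k < T" and c: "0 < c"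
  shows "expectation (\<lambda>\<omega>. of_bool ((\<forall>i<k. u < drifted c (s i) \<omega>) \<and> drifted c (s k) \<omega> \<le> u) * reflected_indicator c (drifted c T \<omega> - b))
    = expectation (\<lambda>\<omega>. of_bool ((\<forall>i<k. u < drifted c (s i) \<omega>) \<and> drifted c (s k) \<omega> \<le> u) * surv c (T - s k) (drifted c (s k) \<omega> - b))"
proof -
  let ?N = "PiM {..k} (\<lambda>_. borel) :: (nat \<Rightarrow> real) measure"
  define A where "A = {v. (\<forall>i\<in>{..<k}. u < v i - c * s i) \<and> v k - c * s k \<le> u}"
  have *: "{v \<in> space ?N. u < v i - c * s i} \<in> sets ?N" "{v \<in> space ?N. v i - c * s i \<le> u} \<in> sets ?N" if "i \<le> k" for i
  proof -
    have [measurable]: "(\<lambda>v. v i) \<in> borel_measurable ?N"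
      by (rule measurable_component_singleton) (use that in simp)
    show "{v \<in> space ?N. u < v i - c * s i} \<in> sets ?N" "{v \<in> space ?N. v i - c * s i \<le> u} \<in> sets ?N"
      by measurable
  qed
  have "A \<inter> space ?N = {v \<in> space ?N. (\<forall>i\<in>{..<k}. u < v i - c * s i) \<and> v k - c * s k \<le> u}"
    by (auto simp: A_def)
  also have "\<dots> \<in> sets ?N"
    by (intro sets.sets_Collect_conj sets.sets_Collect_finite_All *) auto
  finally have A: "A \<inter> space ?N \<in> sets ?N" .
  have ind: "indicator A (\<lambda>i\<in>{..k}. B (s i) \<omega> - B 0 \<omega>)
      = (of_bool ((\<forall>i<k. u < drifted c (s i) \<omega>) \<and> drifted c (s k) \<omega> \<le> u) :: real)" for \<omega>
    by (auto simp: A_def drifted_def indicator_def)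
  show ?thesis
    using expectation_reflected_given_past[OF assms A, of b] unfolding ind .
qed

lemma reflected_mean_eq_surv:
  assumes "0 < S" "S < T" "0 < c"
  shows "reflected_mean c S T b u
    = expectation (\<lambda>\<omega>. of_bool (u < drifted c S \<omega>) * surv c (T - S) (drifted c S \<omega> - b))"
proof -
  let ?N = "PiM {..0} (\<lambda>_. borel) :: (nat \<Rightarrow> real) measure"
  define A where "A = {v :: nat \<Rightarrow> real. u < v 0 - c * S}"
  have [measurable]: "(\<lambda>v. v 0) \<in> borel_measurable ?N"
    by (rule measurable_component_singleton) simp
  have "A \<inter> space ?N = {v \<in> space ?N. u < v 0 - c * S}"
    by (auto simp: A_def)
  also have "\<dots> \<in> sets ?N" by measurable
  finally have A: "A \<inter> space ?N \<in> sets ?N" .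
  have ind: "indicator A (\<lambda>i\<in>{..0}. B S \<omega> - B 0 \<omega>) = (of_bool (u < drifted c S \<omega>) :: real)" for \<omega>
    by (auto simp: A_def drifted_def indicator_def)
  show ?thesis
    using expectation_reflected_given_past[of "\<lambda>_. S" 0 T c A b] assms A
    unfolding ind reflected_mean_def by simp
qed

lemma sets_all_above:
  fixes n :: nat
  assumes "\<And>i. i \<le> n \<Longrightarrow> 0 \<le> s i"
  shows "{\<omega> \<in> space M. \<forall>i\<le>n. u < drifted c (s i) \<omega>} \<in> events"
proof -
  have "{\<omega> \<in> space M. u < drifted c (s i) \<omega>} \<in> events" if "i \<le> n" for i
    using assms[OF that] by measurable
  then have "{\<omega> \<in> space M. \<forall>i\<in>{..n}. u < drifted c (s i) \<omega>} \<in> events"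
    by (intro sets.sets_Collect_finite_All) auto
  then show ?thesis by (simp only: Ball_def atMost_iff)
qed

lemma sets_some_step_large:
  assumes "\<And>i. i \<le> n \<Longrightarrow> 0 \<le> s i"
  shows "{\<omega> \<in> space M. \<exists>j<n. d < \<bar>drifted c (s (Suc j)) \<omega> - drifted c (s j) \<omega>\<bar>} \<in> events"
proof -
  have "{\<omega> \<in> space M. d < \<bar>drifted c (s (Suc j)) \<omega> - drifted c (s j) \<omega>\<bar>} \<in> events" if "j < n" for j
  proof -
    have [measurable]: "drifted c (s j) \<in> borel_measurable M" "drifted c (s (Suc j)) \<in> borel_measurable M"
      using assms[of j] assms[of "Suc j"] that by auto
    show ?thesis by measurable
  qed
  then have "{\<omega> \<in> space M. \<exists>j\<in>{..<n}. d < \<bar>drifted c (s (Suc j)) \<omega> - drifted c (s j) \<omega>\<bar>} \<in> events"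
    by (intro sets.sets_Collect_finite_Ex) auto
  then show ?thesis by (simp only: Bex_def lessThan_iff)
qed

text \<open>On \<open>alive\<close> the final value lies above the mirror, so the reflected
  indicator is 1 there and contributes exactly the probability. The rest is a sum over first
  passages, controlled by the sign of \<open>surv\<close>.\<close>

lemma discrete_reflection:
  fixes s :: "nat \<Rightarrow> real"
  assumes "0 < s 0" and s: "\<And>i. i < n \<Longrightarrow> s i < s (Suc i)" and c: "0 < c" and bu: "b \<le> u"
  defines "alive \<equiv> {\<omega> \<in> space M. \<forall>i\<le>n. u < drifted c (s i) \<omega>}"
  shows "b = u \<Longrightarrow> reflected_mean c (s 0) (s n) b u \<le> prob alive"
    and "prob alive \<le> reflected_mean c (s 0) (s n) b u
      + prob {\<omega> \<in> space M. \<exists>j<n. u - b < \<bar>drifted c (s (Suc j)) \<omega> - drifted c (s j) \<omega>\<bar>}"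
proof -
  have s_less: "s i < s j" if "i < j" "j \<le> n" for i j
    using that
  proof (induction j)
    case (Suc j)
    then show ?case
      using s[of j] by (cases "i = j") (auto intro: less_trans)
  qed simp
  have s_nonneg: "0 \<le> s i" if "i \<le> n" for i
    using s_less[of 0 i] that assms(1) by (cases "i = 0") auto
  note measurable_drifted [measurable del]
  have [measurable]: "drifted c (s i) \<in> borel_measurable M" if "i \<le> n" for i
    using s_nonneg[OF that] by (rule measurable_drifted)
  define R where "R \<omega> = reflected_indicator c (drifted c (s n) \<omega> - b)" for \<omega>
  define hit :: "nat \<Rightarrow> 'a \<Rightarrow> real" where
    "hit k \<omega> = of_bool ((\<forall>i<k. u < drifted c (s i) \<omega>) \<and> drifted c (s k) \<omega> \<le> u)" for k \<omega>
  \<comment> \<open>At the last index no time remains and \<open>surv\<close> would divide by zero,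
    so \<open>R\<close> itself is kept.\<close>
  define Sv where "Sv k \<omega> = (if k = n then R \<omega> else surv c (s n - s k) (drifted c (s k) \<omega> - b))" for k \<omega>
  have [measurable]: "R \<in> borel_measurable M" unfolding R_def[abs_def] by measurable
  have hit_meas [measurable]: "hit k \<in> borel_measurable M" if "k \<le> n" for k
  proof -
    have [measurable]: "drifted c (s i) \<in> borel_measurable M" if "i \<in> {..<k} \<or> i = k" for i
      using that \<open>k \<le> n\<close> by auto
    have *: "hit k = (\<lambda>\<omega>. if (\<forall>i\<in>{..<k}. u < drifted c (s i) \<omega>) \<and> drifted c (s k) \<omega> \<le> u then 1 else 0)"
      by (auto simp: hit_def fun_eq_iff)
    show ?thesis unfolding * by measurable (use \<open>k \<le> n\<close> in auto)
  qed
  have [measurable]: "Sv k \<in> borel_measurable M" if "k \<le> n" for k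
    using that unfolding Sv_def[abs_def] by measurable
  have [measurable]: "alive \<in> events"
    unfolding alive_def using s_nonneg by (rule sets_all_above)
  have R_le: "\<bar>R \<omega>\<bar> \<le> 1" for \<omega>
    unfolding R_def by (rule abs_reflected_indicator_le[OF c])
  have Sv_le: "\<bar>Sv k \<omega>\<bar> \<le> 1" if "k \<le> n" for k \<omega>
    using R_le s_less[of k n] that by (auto simp: Sv_def intro!: abs_surv_le_1 c)
  have hit01: "0 \<le> hit k \<omega>" "hit k \<omega> \<le> 1" for k \<omega> by (auto simp: hit_def)
  have int_hit: "integrable M (\<lambda>\<omega>. hit k \<omega> * f \<omega>)"
    if "k \<le> n" and [measurable]: "f \<in> borel_measurable M" and "\<And>\<omega>. \<bar>f \<omega>\<bar> \<le> 1" for k f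
  proof (rule integrable_const_bound[where B=1])
    show "AE \<omega> in M. norm (hit k \<omega> * f \<omega>) \<le> 1"
      using that(3) by (intro always_eventually allI) (auto simp: hit_def)
    show "(\<lambda>\<omega>. hit k \<omega> * f \<omega>) \<in> borel_measurable M" using that(1) by measurable
  qed
  have pathwise: "of_bool (u < drifted c (s 0) \<omega>) * R \<omega> = indicator alive \<omega> + (\<Sum>k=1..n. hit k \<omega> * R \<omega>)"
    if "\<omega> \<in> space M" for \<omega>
  proof -
    have "of_bool (u < drifted c (s 0) \<omega>) = (indicator alive \<omega> :: real) + (\<Sum>k=1..n. hit k \<omega>)"
      using first_passage_decomposition[of u "\<lambda>i. drifted c (s i) \<omega>" n] that
      by (simp add: alive_def hit_def indicator_def)
    moreover have "indicator alive \<omega> * R \<omega> = indicator alive \<omega>"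
      using bu by (auto simp: alive_def R_def reflected_indicator_def indicator_def)
    ultimately show ?thesis by (simp add: distrib_right sum_distrib_right)
  qed
  have E_hit: "expectation (\<lambda>\<omega>. hit k \<omega> * R \<omega>) = expectation (\<lambda>\<omega>. hit k \<omega> * Sv k \<omega>)" if "k \<le> n" for k
  proof (cases "k = n")
    case False
    then have "k < n" using that by simp
    have "expectation (\<lambda>\<omega>. hit k \<omega> * R \<omega>) = expectation (\<lambda>\<omega>. hit k \<omega> * surv c (s n - s k) (drifted c (s k) \<omega> - b))"
      unfolding hit_def R_def
      by (rule expectation_first_passage) (use assms(1) s c s_less \<open>k < n\<close> in auto)
    then show ?thesis using False by (simp add: Sv_def)
  qed (simp add: Sv_def)
  have H: "reflected_mean c (s 0) (s n) b u = prob alive + (\<Sum>k=1..n. expectation (\<lambda>\<omega>. hit k \<omega> * Sv k \<omega>))"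
  proof -
    have "reflected_mean c (s 0) (s n) b u = expectation (\<lambda>\<omega>. indicator alive \<omega> + (\<Sum>k=1..n. hit k \<omega> * R \<omega>))"
      unfolding reflected_mean_def R_def[symmetric]
      by (rule Bochner_Integration.integral_cong) (use pathwise in auto)
    also have "\<dots> = expectation (indicator alive) + expectation (\<lambda>\<omega>. \<Sum>k=1..n. hit k \<omega> * R \<omega>)"
      by (intro Bochner_Integration.integral_add Bochner_Integration.integrable_sum int_hit R_le
          integrable_const_bound[where B=1 and f="indicator alive"]) auto
    finally have 1: "reflected_mean c (s 0) (s n) b u = prob alive + expectation (\<lambda>\<omega>. \<Sum>k=1..n. hit k \<omega> * R \<omega>)"
      by simp
    have "expectation (\<lambda>\<omega>. \<Sum>k=1..n. hit k \<omega> * R \<omega>) = (\<Sum>k=1..n. expectation (\<lambda>\<omega>. hit k \<omega> * R \<omega>))"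
      by (rule Bochner_Integration.integral_sum) (auto intro!: int_hit R_le)
    also have "\<dots> = (\<Sum>k=1..n. expectation (\<lambda>\<omega>. hit k \<omega> * Sv k \<omega>))"
      by (intro sum.cong refl E_hit) auto
    finally show ?thesis using 1 by simp
  qed
  show "reflected_mean c (s 0) (s n) b u \<le> prob alive" if "b = u"
  proof -
    have "hit k \<omega> * Sv k \<omega> \<le> 0" if "k \<le> n" for k \<omega>
    proof (cases "drifted c (s k) \<omega> \<le> u")
      case True
      then have "Sv k \<omega> \<le> 0"
        using that \<open>b = u\<close> s_less[of k n]
        by (auto simp: Sv_def R_def reflected_indicator_def indicator_def intro!: surv_nonpos)
      then show ?thesis using hit01 by (simp add: mult_nonneg_nonpos)
    qed (simp add: hit_def)
    then have "0 \<le> expectation (\<lambda>\<omega>. - (hit k \<omega> * Sv k \<omega>))" if "k \<le> n" for k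
      using that by (intro Bochner_Integration.integral_nonneg) simp
    then have "(\<Sum>k=1..n. expectation (\<lambda>\<omega>. hit k \<omega> * Sv k \<omega>)) \<le> 0"
      by (intro sum_nonpos) simp
    then show ?thesis using H by simp
  qed
  define big where "big = {\<omega> \<in> space M. \<exists>j<n. u - b < \<bar>drifted c (s (Suc j)) \<omega> - drifted c (s j) \<omega>\<bar>}"
  define below :: "nat \<Rightarrow> 'a \<Rightarrow> real" where "below k \<omega> = of_bool (drifted c (s k) \<omega> < b)" for k \<omega>
  have [measurable]: "below k \<in> borel_measurable M" if "k \<le> n" for k
    using that unfolding below_def[abs_def] by measurable
  have [measurable]: "big \<in> events"
    unfolding big_def using s_nonneg by (rule sets_some_step_large)
  have 1: "- (\<Sum>k=1..n. expectation (\<lambda>\<omega>. hit k \<omega> * Sv k \<omega>)) = (\<Sum>k=1..n. expectation (\<lambda>\<omega>. - (hit k \<omega> * Sv k \<omega>)))"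
    by (simp add: sum_negf)
  have 2: "(\<Sum>k=1..n. expectation (\<lambda>\<omega>. - (hit k \<omega> * Sv k \<omega>))) \<le> (\<Sum>k=1..n. expectation (\<lambda>\<omega>. hit k \<omega> * below k \<omega>))"
  proof (intro sum_mono integral_mono)
    fix k \<omega> assume k: "k \<in> {1..n}"
    then have k': "k \<le> n" by simp
    show "integrable M (\<lambda>\<omega>. - (hit k \<omega> * Sv k \<omega>))" "integrable M (\<lambda>\<omega>. hit k \<omega> * below k \<omega>)"
      using k' by (auto intro!: int_hit Sv_le simp: below_def)
    have "0 \<le> Sv k \<omega>" if "b \<le> drifted c (s k) \<omega>"
      using that k' s_less[of k n]
      by (auto simp: Sv_def R_def reflected_indicator_def indicator_def intro!: surv_nonneg)
    \<comment> \<open>Above the mirror \<open>Sv\<close> is nonnegative; below it only the bound 1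
      is available, and \<open>below\<close> pays for it.\<close>
    then have "- Sv k \<omega> \<le> below k \<omega>"
      using Sv_le[OF k', of \<omega>] by (cases "b \<le> drifted c (s k) \<omega>") (auto simp: below_def)
    then have "hit k \<omega> * (- Sv k \<omega>) \<le> hit k \<omega> * below k \<omega>"
      by (rule mult_left_mono[OF _ hit01(1)])
    then show "- (hit k \<omega> * Sv k \<omega>) \<le> hit k \<omega> * below k \<omega>" by simp
  qed
  have 3: "(\<Sum>k=1..n. expectation (\<lambda>\<omega>. hit k \<omega> * below k \<omega>)) = expectation (\<lambda>\<omega>. \<Sum>k=1..n. hit k \<omega> * below k \<omega>)"
    by (rule Bochner_Integration.integral_sum[symmetric]) (auto intro!: int_hit simp: below_def)
  have 4: "expectation (\<lambda>\<omega>. \<Sum>k=1..n. hit k \<omega> * below k \<omega>) \<le> expectation (indicator big)"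
  proof (rule integral_mono)
    show "integrable M (\<lambda>\<omega>. \<Sum>k=1..n. hit k \<omega> * below k \<omega>)"
      by (intro Bochner_Integration.integrable_sum int_hit) (auto simp: below_def)
    show "(\<Sum>k=1..n. hit k \<omega> * below k \<omega>) \<le> indicator big \<omega>" if "\<omega> \<in> space M" for \<omega>
      using first_passage_overshoot[where x="\<lambda>i. drifted c (s i) \<omega>" and u=u and b=b and n=n] that
      by (simp add: hit_def below_def big_def indicator_def)
  qed (rule integrable_const_bound[where B=1], auto)
  have 5: "expectation (indicator big) = prob big"
    by simp
  show "prob alive \<le> reflected_mean c (s 0) (s n) b u + prob big"
    using 1 2 3 4 5 H by linarith
qed

end

section \<open>Refining the grid\<close>

definition grid :: "real \<Rightarrow> real \<Rightarrow> nat \<Rightarrow> nat \<Rightarrow> real" where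
  "grid S T n k = S + real k * ((T - S) / real n)"

lemma grid_0 [simp]: "grid S T n 0 = S"
  by (simp add: grid_def)

lemma grid_n: "0 < n \<Longrightarrow> grid S T n n = T"
  by (simp add: grid_def)

lemma grid_Suc: "grid S T n (Suc k) = grid S T n k + (T - S) / real n"
  unfolding grid_def of_nat_Suc distrib_right by simp

lemma grid_less_Suc: "S < T \<Longrightarrow> 0 < n \<Longrightarrow> grid S T n i < grid S T n (Suc i)"
  by (simp add: grid_Suc)

lemma grid_mem:
  assumes "S \<le> T" "k \<le> n"
  shows "grid S T n k \<in> {S..T}"
proof (cases "n = 0")
  case False
  have "real k * (T - S) \<le> (T - S) * real n"
    using assms by (subst mult.commute) (intro mult_left_mono, auto)
  then have "real k * ((T - S) / real n) \<le> T - S"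
    using False by (simp add: pos_divide_le_eq)
  moreover have "0 \<le> real k * ((T - S) / real n)"
    using assms by simp
  ultimately show ?thesis
    unfolding grid_def by simp
qed (use assms in \<open>simp add: grid_def\<close>)

lemma eventually_grid_dense:
  assumes "S < T" "t \<in> {S..T}" "0 < \<delta>"
  shows "\<forall>\<^sub>F n in sequentially. \<exists>k\<le>n. \<bar>grid S T n k - t\<bar> < \<delta>"
proof -
  obtain N :: nat where N: "(T - S) / \<delta> < real N"
    using reals_Archimedean2 by blast
  have "0 < (T - S) / \<delta>" using assms by simp
  with N have "0 < N" by linarith
  show ?thesis
    using eventually_ge_at_top[of N]
  proof eventually_elim
    case (elim n)
    then have n: "0 < n" "(T - S) / \<delta> < real n" using N \<open>0 < N\<close> by linarith+
    then have step: "(T - S) / real n < \<delta>" using assms by (simp add: field_simps)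
    \<comment> \<open>The last grid index at or before \<open>t\<close>, so the error is less than
      one step.\<close>
    define k where "k = nat \<lfloor>(t - S) * real n / (T - S)\<rfloor>"
    have pos: "0 \<le> (t - S) * real n / (T - S)" using assms by simp
    then have k: "real k \<le> (t - S) * real n / (T - S)" "(t - S) * real n / (T - S) < real k + 1"
      unfolding k_def by linarith+
    have "(t - S) * real n \<le> (T - S) * real n"
      using assms by (intro mult_right_mono) auto
    then have "(t - S) * real n / (T - S) \<le> real n"
      using assms by (simp add: field_simps)
    with k(1) have "k \<le> n" by linarith
    define q where "q = (T - S) / real n"
    have q: "0 < q" "(t - S) * real n / (T - S) = (t - S) / q"
      using n assms by (simp_all add: q_def)
    have "real k * q \<le> t - S" "t - S < real k * q + q"
      using k q(1) unfolding q(2) by (simp_all add: field_simps)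
    then have "\<bar>grid S T n k - t\<bar> < \<delta>"
      using step unfolding grid_def q_def[symmetric] by linarith
    with \<open>k \<le> n\<close> show ?case by blast
  qed
qed

text \<open>Successive grids are not nested, so monotone continuity of the measure does not apply.
  Dominated convergence of indicators needs only that each path eventually leaves.\<close>

lemma (in prob_space) prob_tendsto_0_if_eventually_not:
  assumes [measurable]: "\<And>n. A n \<in> events"
    and "\<And>\<omega>. \<omega> \<in> space M \<Longrightarrow> \<forall>\<^sub>F n in sequentially. \<omega> \<notin> A n"
  shows "(\<lambda>n. prob (A n)) \<longlonglongrightarrow> 0"
proof -
  have "(\<lambda>n. expectation (indicator (A n))) \<longlonglongrightarrow> (expectation (\<lambda>_. 0) :: real)"
  proof (rule integral_dominated_convergence[where w="\<lambda>_. 1"])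
    show "AE \<omega> in M. (\<lambda>n. indicator (A n) \<omega> :: real) \<longlonglongrightarrow> 0"
    proof (rule AE_I2)
      fix \<omega> assume "\<omega> \<in> space M"
      from assms(2)[OF this] have "\<forall>\<^sub>F n in sequentially. indicator (A n) \<omega> = (0 :: real)"
        by eventually_elim simp
      then show "(\<lambda>n. indicator (A n) \<omega> :: real) \<longlonglongrightarrow> 0" by (rule tendsto_eventually)
    qed
  qed (auto simp: indicator_def)
  then show ?thesis by simp
qed

text \<open>This lets the level tend to \<open>u\<close> in the one-sided bounds. For nonnegative
  \<open>X n\<close> the density at \<open>X n + z\<close> is at most that at \<open>z\<close>,
  which gives the dominating function.\<close>

lemma gaussian_tail_integral_continuous:
  fixes g :: "real \<Rightarrow> real"
  assumes [measurable]: "g \<in> borel_measurable borel" and \<sigma>: "0 < \<sigma>"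
    and bound: "\<And>z. \<bar>g z\<bar> \<le> C" and X: "\<And>n. 0 \<le> X n" "X \<longlonglongrightarrow> a"
  shows "(\<lambda>n. \<integral>z. indicator {0<..} z * g z * normal_density 0 \<sigma> (X n + z) \<partial>lborel)
    \<longlonglongrightarrow> (\<integral>z. indicator {0<..} z * g z * normal_density 0 \<sigma> (a + z) \<partial>lborel)"
proof (rule integral_dominated_convergence[where w="\<lambda>z. normal_density 0 \<sigma> z * C"])
  show "integrable lborel (\<lambda>z. normal_density 0 \<sigma> z * C)"
    using \<sigma> by (intro integrable_mult_left) auto
  show "AE z in lborel. (\<lambda>n. indicator {0<..} z * g z * normal_density 0 \<sigma> (X n + z))
      \<longlonglongrightarrow> indicator {0<..} z * g z * normal_density 0 \<sigma> (a + z)"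
    unfolding normal_density_def using \<sigma> by (intro always_eventually allI tendsto_intros X) auto
  fix n
  show "AE z in lborel. norm (indicator {0<..} z * g z * normal_density 0 \<sigma> (X n + z)) \<le> normal_density 0 \<sigma> z * C"
  proof (intro always_eventually allI)
    fix z
    have C: "0 \<le> C" using bound[of 0] by linarith
    show "norm (indicator {0<..} z * g z * normal_density 0 \<sigma> (X n + z)) \<le> normal_density 0 \<sigma> z * C"
    proof (cases "0 < z")
      case True
      then have "z\<^sup>2 \<le> (X n + z)\<^sup>2"
        using X(1)[of n] by (intro power_mono) auto
      then have "normal_density 0 \<sigma> (X n + z) \<le> normal_density 0 \<sigma> z"
        using \<sigma> by (auto simp: normal_density_def intro!: divide_right_mono mult_left_mono)
      then have "\<bar>g z\<bar> * normal_density 0 \<sigma> (X n + z) \<le> C * normal_density 0 \<sigma> z"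
        using C by (intro mult_mono bound) auto
      then show ?thesis using True by (simp add: abs_mult mult.commute)
    qed (use C in simp)
  qed
qed simp_all

section \<open>From grids to the whole time interval\<close>

context standard_brownian_motion
begin

lemma continuous_on_drifted:
  assumes "\<omega> \<in> space M" "0 \<le> S"
  shows "continuous_on {S..T} (\<lambda>t. drifted c t \<omega>)"
proof -
  have "continuous_on {0..} (\<lambda>t. drifted c t \<omega>)"
    unfolding drifted_def using continuous_paths[OF assms(1)] by (intro continuous_intros)
  then show ?thesis
    by (rule continuous_on_subset) (use assms in auto)
qed

lemma eventually_grid_below:
  assumes "\<omega> \<in> space M" "0 \<le> S" "S < T" "t \<in> {S..T}" "drifted c t \<omega> < v"
  shows "\<forall>\<^sub>F n in sequentially. \<exists>k\<le>n. drifted c (grid S T n k) \<omega> < v"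
proof -
  have "0 < v - drifted c t \<omega>" using assms by simp
  then obtain \<delta> where \<delta>: "0 < \<delta>"
    "\<And>t'. t' \<in> {S..T} \<Longrightarrow> dist t' t < \<delta> \<Longrightarrow> dist (drifted c t' \<omega>) (drifted c t \<omega>) < v - drifted c t \<omega>"
    using continuous_on_drifted[OF assms(1,2), of T c] assms(4) unfolding continuous_on_iff by meson
  show ?thesis
    using eventually_grid_dense[OF assms(3,4) \<delta>(1)]
  proof eventually_elim
    case (elim n)
    then obtain k where k: "k \<le> n" "\<bar>grid S T n k - t\<bar> < \<delta>" by blast
    with \<delta>(2)[of "grid S T n k"] grid_mem[of S T k n] assms(3)
    show ?case by (auto simp: dist_real_def intro!: exI[of _ k])
  qed
qed

lemma eventually_grid_steps_small:
  assumes "\<omega> \<in> space M" "0 \<le> S" "S < T" "0 < \<epsilon>"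
  shows "\<forall>\<^sub>F n in sequentially. \<not> (\<exists>j<n. \<epsilon> < \<bar>drifted c (grid S T n (Suc j)) \<omega> - drifted c (grid S T n j) \<omega>\<bar>)"
proof -
  have "uniformly_continuous_on {S..T} (\<lambda>t. drifted c t \<omega>)"
    by (intro compact_uniformly_continuous continuous_on_drifted assms) auto
  then obtain \<delta> where \<delta>: "0 < \<delta>"
    "\<And>t t'. t \<in> {S..T} \<Longrightarrow> t' \<in> {S..T} \<Longrightarrow> dist t' t < \<delta> \<Longrightarrow> dist (drifted c t' \<omega>) (drifted c t \<omega>) < \<epsilon>"
    using assms(4) unfolding uniformly_continuous_on_def by meson
  have "(\<lambda>n. (T - S) / real n) \<longlonglongrightarrow> 0"
    by (rule lim_const_over_n)
  then have "\<forall>\<^sub>F n in sequentially. (T - S) / real n < \<delta>"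
    using \<delta>(1) by (rule order_tendstoD)
  then show ?thesis
  proof eventually_elim
    case (elim n)
    show ?case
    proof (intro notI, elim exE conjE)
      fix j assume j: "j < n" and big: "\<epsilon> < \<bar>drifted c (grid S T n (Suc j)) \<omega> - drifted c (grid S T n j) \<omega>\<bar>"
      have "dist (grid S T n (Suc j)) (grid S T n j) < \<delta>"
        using elim assms(3) by (simp add: dist_real_def grid_Suc)
      with \<delta>(2)[of "grid S T n j" "grid S T n (Suc j)"] grid_mem[of S T j n] grid_mem[of S T "Suc j" n] j assms(3) big
      show False by (simp add: dist_real_def)
    qed
  qed
qed

text \<open>The weak inequality passes to limits, so by path continuity it is equivalent to the
  inequality at all grid points; this gives measurability. A strict one could fail between
  them.\<close>

definition stays_above :: "real \<Rightarrow> real \<Rightarrow> real \<Rightarrow> real \<Rightarrow> 'a set" where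
  "stays_above c S T v = {\<omega> \<in> space M. \<forall>t\<in>{S..T}. v \<le> drifted c t \<omega>}"

lemma sets_stays_above [measurable]:
  assumes "0 \<le> S" "S < T"
  shows "stays_above c S T v \<in> events"
proof -
  have "stays_above c S T v = {\<omega> \<in> space M. \<forall>n. \<forall>k\<in>{..n}. v \<le> drifted c (grid S T n k) \<omega>}"
  proof (intro equalityI subsetI)
    fix \<omega> assume "\<omega> \<in> stays_above c S T v"
    then show "\<omega> \<in> {\<omega> \<in> space M. \<forall>n. \<forall>k\<in>{..n}. v \<le> drifted c (grid S T n k) \<omega>}"
      using grid_mem[of S T] assms by (auto simp: stays_above_def)
  next
    fix \<omega> assume *: "\<omega> \<in> {\<omega> \<in> space M. \<forall>n. \<forall>k\<in>{..n}. v \<le> drifted c (grid S T n k) \<omega>}"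
    have "v \<le> drifted c t \<omega>" if t: "t \<in> {S..T}" for t
    proof (rule ccontr)
      assume "\<not> v \<le> drifted c t \<omega>"
      with eventually_grid_below[of \<omega> S T t c v] * assms t
      have "\<forall>\<^sub>F n in sequentially. \<exists>k\<le>n. drifted c (grid S T n k) \<omega> < v" by auto
      then obtain n k where "k \<le> n" "drifted c (grid S T n k) \<omega> < v"
        using eventually_happens'[OF sequentially_bot] by blast
      with * show False by force
    qed
    with * show "\<omega> \<in> stays_above c S T v" by (auto simp: stays_above_def)
  qed
  also have "\<dots> \<in> events"
  proof (intro sets.sets_Collect_countable_All sets.sets_Collect_finite_All)
    fix n k :: nat assume "k \<in> {..n}"
    then have "0 \<le> grid S T n k" using grid_mem[of S T k n] assms by auto
    then have [measurable]: "drifted c (grid S T n k) \<in> borel_measurable M" by (rule measurable_drifted)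
    show "{\<omega> \<in> space M. v \<le> drifted c (grid S T n k) \<omega>} \<in> events" by measurable
  qed simp
  finally show ?thesis .
qed

text \<open>Staying above on a grid does not imply staying above in between, but every path
  eventually leaves this excess event, so its probability vanishes.\<close>

lemma reflected_mean_le_prob:
  assumes S: "0 < S" "S < T" and c: "0 < c"
  shows "reflected_mean c S T u u \<le> prob (stays_above c S T u)"
proof -
  \<comment> \<open>\<open>Suc n\<close> avoids the grid without cells, whose last point is not
    \<open>T\<close>.\<close>
  define alive where "alive n = {\<omega> \<in> space M. \<forall>i\<le>Suc n. u < drifted c (grid S T (Suc n) i) \<omega>}" for n
  have grid_nonneg: "0 \<le> grid S T n i" if "i \<le> n" for n i
    using grid_mem[of S T i n] S that by auto
  have [measurable]: "alive n \<in> events" for n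
    unfolding alive_def using grid_nonneg by (rule sets_all_above)
  have ab [measurable]: "stays_above c S T u \<in> events"
    by (rule sets_stays_above) (use S in auto)
  have "(\<lambda>n. prob (alive n - stays_above c S T u)) \<longlonglongrightarrow> 0"
  proof (rule prob_tendsto_0_if_eventually_not)
    fix \<omega> assume \<omega>: "\<omega> \<in> space M"
    show "\<forall>\<^sub>F n in sequentially. \<omega> \<notin> alive n - stays_above c S T u"
    proof (cases "\<omega> \<in> stays_above c S T u")
      case False
      then obtain t where "t \<in> {S..T}" "drifted c t \<omega> < u"
        using \<omega> by (auto simp: stays_above_def not_le)
      with eventually_grid_below[OF \<omega>, of S T t c u] S
      have "\<forall>\<^sub>F n in sequentially. \<exists>k\<le>n. drifted c (grid S T n k) \<omega> < u" by simp
      then have "\<forall>\<^sub>F n in sequentially. \<exists>k\<le>Suc n. drifted c (grid S T (Suc n) k) \<omega> < u"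
        by (rule eventually_compose_filterlim[OF _ filterlim_Suc])
      then show ?thesis
        by eventually_elim (auto simp: alive_def not_less dest: less_imp_le)
    qed simp
  qed measurable
  from tendsto_add[OF tendsto_const this, of "prob (stays_above c S T u)"]
  have lim: "(\<lambda>n. prob (stays_above c S T u) + prob (alive n - stays_above c S T u)) \<longlonglongrightarrow> prob (stays_above c S T u)"
    by simp
  have "reflected_mean c S T u u \<le> prob (stays_above c S T u) + prob (alive n - stays_above c S T u)" for n
  proof -
    have "reflected_mean c (grid S T (Suc n) 0) (grid S T (Suc n) (Suc n)) u u \<le> prob (alive n)"
      unfolding alive_def
      by (rule discrete_reflection(1)) (use S c in \<open>auto intro: grid_less_Suc\<close>)
    then have "reflected_mean c S T u u \<le> prob (alive n)"
      by (simp add: grid_n)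
    also have "\<dots> \<le> prob (stays_above c S T u \<union> (alive n - stays_above c S T u))"
      by (intro finite_measure_mono) auto
    also have "\<dots> \<le> prob (stays_above c S T u) + prob (alive n - stays_above c S T u)"
      by (intro measure_Un_le) auto
    finally show ?thesis .
  qed
  then show ?thesis
    using LIMSEQ_le_const[OF lim] by blast
qed

text \<open>Raising the threshold from \<open>b\<close> to \<open>u\<close> discards only
  nonnegative values of \<open>surv\<close>.\<close>

lemma reflected_mean_mono:
  assumes S: "0 < S" "S < T" and c: "0 < c" and "b \<le> u"
  shows "reflected_mean c S T b u \<le> reflected_mean c S T b b"
proof -
  have [measurable]: "drifted c S \<in> borel_measurable M"
    using S by (intro measurable_drifted) auto
  have T: "0 < T - S" using S by simp
  have int: "integrable M (\<lambda>\<omega>. of_bool (v < drifted c S \<omega>) * surv c (T - S) (drifted c S \<omega> - b))" for v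
    using abs_surv_le_1[OF T c] by (intro integrable_const_bound[where B=1]) auto
  show ?thesis
    unfolding reflected_mean_eq_surv[OF S c]
  proof (intro integral_mono int)
    fix \<omega>
    show "of_bool (u < drifted c S \<omega>) * surv c (T - S) (drifted c S \<omega> - b)
        \<le> of_bool (b < drifted c S \<omega>) * surv c (T - S) (drifted c S \<omega> - b)"
      using \<open>b \<le> u\<close> surv_nonneg[OF T, of "drifted c S \<omega> - b" c] by auto
  qed
qed

lemma prob_le_reflected_mean:
  assumes S: "0 < S" "S < T" and c: "0 < c" and "b < u"
  shows "prob (stays_above c S T u) \<le> reflected_mean c S T b b"
proof -
  \<comment> \<open>The midpoint leaves room on both sides: a path at least \<open>u\<close> is
    strictly above \<open>v\<close>, and falling from above \<open>v\<close> to below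
    \<open>b\<close> takes a step larger than the fixed \<open>v - b\<close>.\<close>
  define v where "v = (b + u) / 2"
  have v: "b < v" "v < u" using \<open>b < u\<close> by (auto simp: v_def)
  define alive where "alive n = {\<omega> \<in> space M. \<forall>i\<le>Suc n. v < drifted c (grid S T (Suc n) i) \<omega>}" for n
  define big where "big n = {\<omega> \<in> space M. \<exists>j<n. v - b < \<bar>drifted c (grid S T n (Suc j)) \<omega> - drifted c (grid S T n j) \<omega>\<bar>}" for n
  have grid_nonneg: "0 \<le> grid S T n i" if "i \<le> n" for n i
    using grid_mem[of S T i n] S that by auto
  have [measurable]: "alive n \<in> events" for n
    unfolding alive_def using grid_nonneg by (rule sets_all_above)
  have "(\<lambda>n. prob (big n)) \<longlonglongrightarrow> 0"
  proof (rule prob_tendsto_0_if_eventually_not)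
    show "big n \<in> events" for n
      unfolding big_def using grid_nonneg by (rule sets_some_step_large)
    fix \<omega> assume \<omega>: "\<omega> \<in> space M"
    have "\<forall>\<^sub>F n in sequentially. \<not> (\<exists>j<n. v - b < \<bar>drifted c (grid S T n (Suc j)) \<omega> - drifted c (grid S T n j) \<omega>\<bar>)"
      by (rule eventually_grid_steps_small) (use \<omega> S v in auto)
    then show "\<forall>\<^sub>F n in sequentially. \<omega> \<notin> big n"
      by eventually_elim (simp add: big_def)
  qed
  then have lim: "(\<lambda>n. reflected_mean c S T b b + prob (big (Suc n))) \<longlonglongrightarrow> reflected_mean c S T b b + 0"
    by (intro tendsto_add tendsto_const LIMSEQ_Suc)
  have "prob (stays_above c S T u) \<le> reflected_mean c S T b b + prob (big (Suc n))" for n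
  proof -
    have "prob (stays_above c S T u) \<le> prob (alive n)"
    proof (rule finite_measure_mono)
      show "stays_above c S T u \<subseteq> alive n"
      proof
        fix \<omega> assume "\<omega> \<in> stays_above c S T u"
        then have "\<omega> \<in> space M" "\<And>t. t \<in> {S..T} \<Longrightarrow> u \<le> drifted c t \<omega>"
          by (auto simp: stays_above_def)
        then show "\<omega> \<in> alive n"
          using grid_mem[of S T _ "Suc n"] S by (auto simp: alive_def intro: less_le_trans[OF v(2)])
      qed
    qed simp
    also have "\<dots> \<le> reflected_mean c (grid S T (Suc n) 0) (grid S T (Suc n) (Suc n)) b v + prob (big (Suc n))"
      unfolding alive_def big_def
      by (rule discrete_reflection(2)) (use S c v in \<open>auto intro: grid_less_Suc\<close>)
    also have "\<dots> = reflected_mean c S T b v + prob (big (Suc n))"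
      by (simp add: grid_n)
    also have "\<dots> \<le> reflected_mean c S T b b + prob (big (Suc n))"
      using reflected_mean_mono[OF S c, of b v] v by simp
    finally show ?thesis .
  qed
  then show ?thesis
    using LIMSEQ_le_const[OF lim] by auto
qed

lemma reflected_mean_eq_integral:
  assumes S: "0 < S" "S < T" and c: "0 < c"
  shows "reflected_mean c S T u u
    = (\<integral>z. indicator {0<..} z * surv c (T - S) z * normal_density 0 (sqrt S) (u + c * S + z) \<partial>lborel)"
proof -
  have D: "distributed M lborel (\<lambda>\<omega>. B S \<omega> - B 0 \<omega>) (normal_density 0 (sqrt S))"
    using normal_increments[of 0 S] S by simp
  let ?h = "\<lambda>x. of_bool (u < x - c * S) * surv c (T - S) (x - c * S - u)"
  have "reflected_mean c S T u u = expectation (\<lambda>\<omega>. ?h (B S \<omega> - B 0 \<omega>))"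
    unfolding reflected_mean_eq_surv[OF S c] drifted_def ..
  also have "\<dots> = (\<integral>x. normal_density 0 (sqrt S) x * ?h x \<partial>lborel)"
    by (rule distributed_integral[OF D, symmetric]) auto
  also have "\<dots> = (\<integral>z. normal_density 0 (sqrt S) (u + c * S + z) * ?h (u + c * S + z) \<partial>lborel)"
    by (subst lborel_integral_real_affine[where c=1 and t="u + c * S"]) auto
  also have "\<dots> = (\<integral>z. indicator {0<..} z * surv c (T - S) z * normal_density 0 (sqrt S) (u + c * S + z) \<partial>lborel)"
    by (intro Bochner_Integration.integral_cong) (auto simp: indicator_def)
  finally show ?thesis .
qed

lemma bdd_below_drifted:
  assumes "\<omega> \<in> space M" "0 \<le> S"
  shows "bdd_below ((\<lambda>t. drifted c t \<omega>) ` {S..T})"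
  by (intro bounded_imp_bdd_below compact_imp_bounded compact_continuous_image continuous_on_drifted assms) simp

text \<open>The bounds at levels \<open>u + \<epsilon> n\<close> and \<open>u - \<epsilon> n\<close>
  enclose the probability, and continuity of the Gaussian integral closes the gap, including that
  between strict and weak inequality.\<close>

lemma prob_INF_eq:
  assumes S: "0 < S" "S < T" and c: "0 < c" and u: "0 < u"
  shows "prob {\<omega> \<in> space M. u < (INF t\<in>{S..T}. B t \<omega> - c * t)}
    = (\<integral>z. indicator {0<..} z * surv c (T - S) z * normal_density 0 (sqrt S) (u + c * S + z) \<partial>lborel)"
    (is "prob ?E = ?H u")
proof -
  define I where "I \<omega> = (INF t\<in>{S..T}. drifted c t \<omega>)" for \<omega>
  have le_I: "v \<le> I \<omega> \<longleftrightarrow> (\<forall>t\<in>{S..T}. v \<le> drifted c t \<omega>)" if "\<omega> \<in> space M" for v \<omega>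
    unfolding I_def using bdd_below_drifted[OF that, of S c T] S by (intro le_cINF_iff) auto
  have stays: "stays_above c S T v = {\<omega> \<in> space M. v \<le> I \<omega>}" for v
    using le_I by (auto simp: stays_above_def)
  have [measurable]: "I \<in> borel_measurable M"
    unfolding borel_measurable_iff_ge stays[symmetric] using S by (auto intro: sets_stays_above)
  have [measurable]: "B 0 \<in> borel_measurable M" by (rule random_variable_at) simp
  have INF_eq: "(INF t\<in>{S..T}. B t \<omega> - c * t) = I \<omega> + B 0 \<omega>" if "\<omega> \<in> space M" for \<omega>
  proof (rule antisym)
    have bdd: "bdd_below ((\<lambda>t. drifted c t \<omega>) ` {S..T})"
      using bdd_below_drifted[OF that] S by simp
    have bdd': "bdd_below ((\<lambda>t. B t \<omega> - c * t) ` {S..T})"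
    proof -
      obtain m where "\<forall>x\<in>(\<lambda>t. drifted c t \<omega>) ` {S..T}. m \<le> x"
        using bdd unfolding bdd_below_def by blast
      then show ?thesis
        by (intro bdd_belowI2[where m="m + B 0 \<omega>"]) (force simp: drifted_def)
    qed
    show "I \<omega> + B 0 \<omega> \<le> (INF t\<in>{S..T}. B t \<omega> - c * t)"
    proof (rule cINF_greatest)
      fix t assume "t \<in> {S..T}"
      then have "I \<omega> \<le> drifted c t \<omega>" unfolding I_def by (rule cINF_lower[OF bdd])
      then show "I \<omega> + B 0 \<omega> \<le> B t \<omega> - c * t" by (simp add: drifted_def)
    qed (use S in simp)
    have "(INF t\<in>{S..T}. B t \<omega> - c * t) - B 0 \<omega> \<le> I \<omega>"
      unfolding I_def
    proof (rule cINF_greatest)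
      fix t assume "t \<in> {S..T}"
      then have "(INF t\<in>{S..T}. B t \<omega> - c * t) \<le> B t \<omega> - c * t" by (rule cINF_lower[OF bdd'])
      then show "(INF t\<in>{S..T}. B t \<omega> - c * t) - B 0 \<omega> \<le> drifted c t \<omega>" by (simp add: drifted_def)
    qed (use S in simp)
    then show "(INF t\<in>{S..T}. B t \<omega> - c * t) \<le> I \<omega> + B 0 \<omega>" by simp
  qed
  have "?E = {\<omega> \<in> space M. u < I \<omega> + B 0 \<omega>}"
    using INF_eq by auto
  then have "prob ?E = prob {\<omega> \<in> space M. u < I \<omega> + B 0 \<omega>}" by simp
  also have "\<dots> = prob {\<omega> \<in> space M. u < I \<omega>}"
    by (rule finite_measure_eq_AE) (use starts_at_zero in \<open>auto elim!: eventually_mono\<close>)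
  finally have E: "prob ?E = prob {\<omega> \<in> space M. u < I \<omega>}" .
  \<comment> \<open>Fractions of \<open>u\<close> keep \<open>u - \<epsilon> n\<close> nonnegative,
    as the continuity argument requires.\<close>
  define \<epsilon> where "\<epsilon> n = u / real (Suc (Suc n))" for n
  have \<epsilon>: "0 < \<epsilon> n" "\<epsilon> n \<le> u" for n
    using u by (auto simp: \<epsilon>_def field_simps)
  have \<epsilon>0: "\<epsilon> \<longlonglongrightarrow> 0"
    unfolding \<epsilon>_def by (intro LIMSEQ_Suc lim_const_over_n)
  have T: "0 < T - S" using S by simp
  have H_lim: "(\<lambda>n. ?H (X n)) \<longlonglongrightarrow> ?H u" if "\<And>n. 0 \<le> X n" "X \<longlonglongrightarrow> u" for X
    using that S c
    by (intro gaussian_tail_integral_continuous[where C=1] measurable_surv abs_surv_le_1[OF T c] tendsto_intros) auto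
  have "?H (u + \<epsilon> n) \<le> prob ?E" for n
  proof -
    have "?H (u + \<epsilon> n) \<le> prob {\<omega> \<in> space M. u + \<epsilon> n \<le> I \<omega>}"
      using reflected_mean_le_prob[OF S c] unfolding reflected_mean_eq_integral[OF S c] stays .
    also have "\<dots> \<le> prob ?E"
      unfolding E using \<epsilon>[of n] by (intro finite_measure_mono) auto
    finally show ?thesis .
  qed
  moreover have "(\<lambda>n. ?H (u + \<epsilon> n)) \<longlonglongrightarrow> ?H u"
    using \<epsilon> u tendsto_add[OF tendsto_const \<epsilon>0, of u] by (intro H_lim) (auto simp: less_imp_le)
  ultimately have "?H u \<le> prob ?E"
    by (intro LIMSEQ_le_const2) auto
  have "prob ?E \<le> ?H (u - \<epsilon> n)" for n
  proof -
    have "prob ?E \<le> prob (stays_above c S T u)"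
      unfolding E stays by (intro finite_measure_mono) auto
    also have "\<dots> \<le> ?H (u - \<epsilon> n)"
      using prob_le_reflected_mean[OF S c] \<epsilon>[of n] unfolding reflected_mean_eq_integral[OF S c] by simp
    finally show ?thesis .
  qed
  moreover have "(\<lambda>n. ?H (u - \<epsilon> n)) \<longlonglongrightarrow> ?H u"
    using \<epsilon> tendsto_diff[OF tendsto_const \<epsilon>0, of u] by (intro H_lim) auto
  ultimately have "prob ?E \<le> ?H u"
    by (intro LIMSEQ_le_const) auto
  with \<open>?H u \<le> prob ?E\<close> show ?thesis by simp
qed

end

section \<open>Comparison of the exact integral with the Gaussian tail\<close>

theorem theorem2p1:
  fixes M :: "'a measure" and B :: "real \<Rightarrow> 'a \<Rightarrow> real" and c T1 T2 :: real
  assumes "standard_brownian_motion M B"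
    and "c > 0"
    and "0 < T1" and "T1 < T2"
  shows "(\<forall>y>0. K_const c y > 0) \<and>
    ((\<lambda>u. measure M {\<omega> \<in> space M. (INF t\<in>{T1..T2}. B t \<omega> - c * t) > u} /
          (K_const c (T2 - T1) * (T1 / u) * std_normal_tail ((u + c * T1) / sqrt T1)))
      \<longlongrightarrow> 1) at_top"
proof (intro conjI allI impI K_const_pos)
  interpret standard_brownian_motion M B by (rule assms)
  define \<sigma> where "\<sigma> = sqrt T1"
  define K where "K = K_const c (T2 - T1)"
  have \<sigma>: "0 < \<sigma>" "\<sigma>\<^sup>2 = T1" using assms by (auto simp: \<sigma>_def)
  have T: "0 < T2 - T1" using assms by simp
  have K: "0 < K" unfolding K_def by (rule K_const_pos[OF T])
  define H where "H a = (\<integral>z. indicator {0<..} z * surv c (T2 - T1) z * normal_density 0 \<sigma> (a + z) \<partial>lborel)" for a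
  obtain C where C: "\<And>z. 0 < z \<Longrightarrow> \<bar>surv c (T2 - T1) z\<bar> \<le> C * z"
    using surv_asymptotics(2)[OF T assms(2)] by blast
  \<comment> \<open>Exponent 1 with slope \<open>K\<close>: the integral takes one more power of
    \<open>a\<close> than the Mills ratio, which is the source of the factor T1/u.\<close>
  have num: "((\<lambda>a. H a * a ^ 2 / normal_density 0 \<sigma> a) \<longlongrightarrow> K * \<sigma> ^ 4) at_top"
    using gaussian_tail_integral_asymptotics[of "surv c (T2 - T1)" \<sigma> C 1 K] \<sigma>(1) C
      surv_asymptotics(1)[OF T assms(2)]
    by (simp add: H_def K_def numeral_eq_Suc)
  have "filterlim (\<lambda>a. a / \<sigma>) at_top at_top"
    using \<sigma>(1) by real_asymp
  from filterlim_compose[OF std_normal_tail_asymptotics this]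
  have den: "((\<lambda>a. \<Psi> (a / \<sigma>) * (a / \<sigma>) / std_normal_density (a / \<sigma>)) \<longlongrightarrow> 1) at_top" .
  have nd: "normal_density 0 \<sigma> a = std_normal_density (a / \<sigma>) / \<sigma>" for a
    using normal_density_standardize[OF \<sigma>(1), of 0 "a / \<sigma>"] \<sigma>(1) by simp
  let ?a = "\<lambda>u. u + c * T1"
  have a_top: "filterlim ?a at_top at_top"
    by real_asymp
  \<comment> \<open>The expansions are in powers of \<open>u + c * T1\<close>; this replaces the
    remaining power by \<open>u\<close>.\<close>
  have ratio: "((\<lambda>u. u / ?a u) \<longlongrightarrow> 1) at_top"
    by real_asymp
  have "((\<lambda>u. (H (?a u) * ?a u ^ 2 / normal_density 0 \<sigma> (?a u))
        / (\<Psi> (?a u / \<sigma>) * (?a u / \<sigma>) / std_normal_density (?a u / \<sigma>)) * (u / ?a u) / (K * \<sigma> ^ 4))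
      \<longlongrightarrow> (K * \<sigma> ^ 4) / 1 * 1 / (K * \<sigma> ^ 4)) at_top"
    using K \<sigma>(1)
    by (intro tendsto_intros filterlim_compose[OF num a_top] filterlim_compose[OF den a_top] ratio) auto
  then have lim: "((\<lambda>u. (H (?a u) * ?a u ^ 2 / normal_density 0 \<sigma> (?a u))
        / (\<Psi> (?a u / \<sigma>) * (?a u / \<sigma>) / std_normal_density (?a u / \<sigma>)) * (u / ?a u) / (K * \<sigma> ^ 4))
      \<longlongrightarrow> 1) at_top"
    using K \<sigma>(1) by simp
  have "\<forall>\<^sub>F u in at_top. (H (?a u) * ?a u ^ 2 / normal_density 0 \<sigma> (?a u))
        / (\<Psi> (?a u / \<sigma>) * (?a u / \<sigma>) / std_normal_density (?a u / \<sigma>)) * (u / ?a u) / (K * \<sigma> ^ 4)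
      = measure M {\<omega> \<in> space M. (INF t\<in>{T1..T2}. B t \<omega> - c * t) > u} /
          (K_const c (T2 - T1) * (T1 / u) * \<Psi> ((u + c * T1) / sqrt T1))"
    using eventually_gt_at_top[of 0]
  proof eventually_elim
    case (elim u)
    have P: "measure M {\<omega> \<in> space M. (INF t\<in>{T1..T2}. B t \<omega> - c * t) > u} = H (?a u)"
      using prob_INF_eq[OF assms(3,4,2) elim] by (simp add: H_def \<sigma>_def)
    \<comment> \<open>For \<open>p = 0\<close> both sides are 0 by division by zero; otherwise the
      factors cancel.\<close>
    have alg: "(h * a ^ 2 / (f / \<sigma>)) / (p * (a / \<sigma>) / f) * (u / a) / (K * \<sigma> ^ 4) = h / (K * (\<sigma>\<^sup>2 / u) * p)"
      if "0 < a" "0 < f" for a f h p :: real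
      using that elim \<sigma>(1) K by (cases "p = 0") (simp_all add: field_simps power2_eq_square power4_eq_xxxx)
    have "0 < ?a u" using elim assms by (simp add: add_pos_pos)
    from alg[OF this normal_density_pos[of 1 0 "?a u / \<sigma>"], of "H (?a u)" "\<Psi> (?a u / \<sigma>)"]
    show ?case
      unfolding P nd K_def[symmetric] \<sigma>(2) \<sigma>_def[symmetric] by simp
  qed
  then show "((\<lambda>u. measure M {\<omega> \<in> space M. (INF t\<in>{T1..T2}. B t \<omega> - c * t) > u} /
          (K_const c (T2 - T1) * (T1 / u) * std_normal_tail ((u + c * T1) / sqrt T1)))
      \<longlongrightarrow> 1) at_top"
    by (rule Lim_transform_eventually[OF lim])
qed

end
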